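(* Let $\Xi(L)=\mathcal D^\intercal\big((I+\mathcal B L)^\intercal\mathcal Q(I+\mathcal B L)+L^\intercal\mathcal R L\big)\mathcal D$. The convex program $$\min_{\lambda I\succ\Xi(L)}\ \lambda\Big(\varepsilon^2-\operatorname{tr}[\Sigma_w]+\lambda\operatorname{tr}\big[\Sigma_w(\lambda I-\Xi(L))^{-1}\big]\Big)$$ is equivalent to (has the same optimal value as) the semidefinite program $$\begin{aligned}\min_{\lambda\ge0,\ \Gamma\succeq0,\ \Psi\succeq0}\quad&\lambda\big(\varepsilon^2-\operatorname{tr}[\Sigma_w]\big)+\operatorname{tr}[\Gamma]\\ \text{s.t.}\quad&\begin{bmatrix}\Gamma&\lambda\Sigma_w^{1/2}\\ \lambda\Sigma_w^{1/2}&\Psi\end{bmatrix}\succeq0,\\ &\begin{bmatrix}\lambda I-\mathcal D^\intercal\tilde M(L)\mathcal D-\Psi&\mathcal D^\intercal L^\intercal\\ L\mathcal D&\tilde{\mathcal R}^{-1}\end{bmatrix}\succeq0,\end{aligned}$$ where $\tilde M(L)=\mathcal Q+M(L)+M(L)^\intercal$, $M(L)=\mathcal Q\mathcal B L$, and $\tilde{\mathcal R}=\mathcal B^\intercal\mathcal Q\mathcal B+\mathcal R$.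
   Context: $N,n,m,d$ are positive integers and $A\in\mathbb R^{n\times n}$, $B\in\mathbb R^{n\times m}$, $D\in\mathbb R^{n\times d}$. The matrices $\mathcal B\in\mathbb R^{(N+1)n\times Nm}$ and $\mathcal D\in\mathbb R^{(N+1)n\times Nd}$ have $(k,i)$ block ($k=0,\dots,N$, $i=0,\dots,N-1$) equal to $A^{k-1-i}B$, respectively $A^{k-1-i}D$, if $i<k$ and $0$ otherwise. $L\in\mathbb R^{Nm\times(N+1)n}$ is of the form $L=K(I-\mathcal B K)^{-1}$ with $K$ a block lower-triangular stacked feedback gain. $\mathcal Q=\mathrm{blkdiag}(Q_0,\dots,Q_{N-1},0)$ with $Q_k\in\mathbb R^{n\times n}$, $Q_k\succeq0$, and $\mathcal R=\mathrm{blkdiag}(R_0,\dots,R_{N-1})$ with $R_k\in\mathbb R^{m\times m}$, $R_k\succ0$. $\Sigma_w\in\mathbb R^{Nd\times Nd}$, $\Sigma_w\succ0$, $\varepsilon>0$. The variables $\Gamma,\Psi$ are symmetric $Nd\times Nd$ matrices. Min refers to the optimal value (infimum). *)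

theory Defs
  imports
    "Jordan_Normal_Form.Gauss_Jordan_Elimination"
    "HOL-Library.Extended_Real"
begin

definition trace_mat :: "real mat \<Rightarrow> real" where
  "trace_mat A = (\<Sum>i<dim_row A. A $$ (i, i))"

text \<open>Definiteness includes symmetry, and symmetry forces the matrix to be square.\<close>

definition pos_semidef :: "real mat \<Rightarrow> bool" where
  "pos_semidef A \<longleftrightarrow> A\<^sup>T = A \<and> (\<forall>x \<in> carrier_vec (dim_row A). 0 \<le> x \<bullet> (A *\<^sub>v x))"

definition pos_def :: "real mat \<Rightarrow> bool" where
  "pos_def A \<longleftrightarrow>
     A\<^sup>T = A \<and> (\<forall>x \<in> carrier_vec (dim_row A). x \<noteq> 0\<^sub>v (dim_row A) \<longrightarrow> 0 < x \<bullet> (A *\<^sub>v x))"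

text \<open>The inverse is unspecified if the matrix is not invertible.\<close>

definition mat_inv :: "real mat \<Rightarrow> real mat" where
  "mat_inv A = the (mat_inverse A)"

definition mat_sqrt :: "real mat \<Rightarrow> real mat" where
  "mat_sqrt A = (THE S. pos_semidef S \<and> S * S = A)"

text \<open>
  The matrix taking the stacked inputs over \<open>N\<close> steps to the stacked states at times \<open>0, \<dots>, N\<close>
  of \<open>x (k + 1) = A x k + G u k\<close> with \<open>x 0 = 0\<close>.  Its block \<open>(k, i)\<close> is \<open>A ^ (k - 1 - i) G\<close>
  if \<open>i < k\<close>, and \<open>0\<close> otherwise; an entry \<open>(r, c)\<close> lies in the block given by the quotients of
  \<open>r\<close> and \<open>c\<close> by the block dimensions, at the position given by the remainders.
\<close>

definition stacked_response :: "nat \<Rightarrow> real mat \<Rightarrow> real mat \<Rightarrow> real mat" where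
  "stacked_response N A G =
     mat ((N + 1) * dim_row G) (N * dim_col G)
       (\<lambda>(r, c).
          let k = r div dim_row G; i = c div dim_col G
          in if i < k
             then (A ^\<^sub>m (k - 1 - i) * G) $$ (r mod dim_row G, c mod dim_col G)
             else 0)"

text \<open>
  Stacked gains of causal state feedback \<open>u i = (\<Sum>k\<le>i. K i k * x k)\<close> with \<open>m\<close> inputs and
  \<open>n\<close> states: the block \<open>(i, k)\<close>, of size \<open>m \<times> n\<close>, vanishes for \<open>k > i\<close>.
\<close>

definition causal_gain :: "nat \<Rightarrow> nat \<Rightarrow> nat \<Rightarrow> real mat \<Rightarrow> bool" where
  "causal_gain N n m K \<longleftrightarrow>
     K \<in> carrier_mat (N * m) ((N + 1) * n) \<and>
     (\<forall>r < N * m. \<forall>c < (N + 1) * n. r div m < c div n \<longrightarrow> K $$ (r, c) = 0)"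

definition Xi :: "real mat \<Rightarrow> real mat \<Rightarrow> real mat \<Rightarrow> real mat \<Rightarrow> real mat \<Rightarrow> real mat" where
  "Xi \<B> \<D> \<Q> \<R> L =
     \<D>\<^sup>T * ((1\<^sub>m (dim_row \<B>) + \<B> * L)\<^sup>T * \<Q> * (1\<^sub>m (dim_row \<B>) + \<B> * L) + L\<^sup>T * \<R> * L) * \<D>"

definition M_mat :: "real mat \<Rightarrow> real mat \<Rightarrow> real mat \<Rightarrow> real mat" where
  "M_mat \<B> \<Q> L = \<Q> * \<B> * L"

definition M_tilde :: "real mat \<Rightarrow> real mat \<Rightarrow> real mat \<Rightarrow> real mat" where
  "M_tilde \<B> \<Q> L = \<Q> + M_mat \<B> \<Q> L + (M_mat \<B> \<Q> L)\<^sup>T"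

definition R_tilde :: "real mat \<Rightarrow> real mat \<Rightarrow> real mat \<Rightarrow> real mat" where
  "R_tilde \<B> \<Q> \<R> = \<B>\<^sup>T * \<Q> * \<B> + \<R>"

text \<open>Optimal values are infima in the extended reals, so they need no side conditions.\<close>

definition dual_value :: "real \<Rightarrow> real mat \<Rightarrow> real mat \<Rightarrow> ereal" where
  "dual_value \<epsilon> \<Sigma> X =
     (INF l \<in> {l. pos_def (l \<cdot>\<^sub>m 1\<^sub>m (dim_row \<Sigma>) - X)}.
        ereal (l * (\<epsilon>\<^sup>2 - trace_mat \<Sigma>
          + l * trace_mat (\<Sigma> * mat_inv (l \<cdot>\<^sub>m 1\<^sub>m (dim_row \<Sigma>) - X)))))"

definition sdp_feasible ::
  "real mat \<Rightarrow> real mat \<Rightarrow> real mat \<Rightarrow> real mat \<Rightarrow> real mat \<Rightarrow> real mat \<Rightarrow> (real \<times> real mat \<times> real mat) set"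
  where
  "sdp_feasible \<Sigma> \<B> \<D> \<Q> \<R> L =
     {(l, \<Gamma>, \<Psi>).
        0 \<le> l \<and>
        \<Gamma> \<in> carrier_mat (dim_row \<Sigma>) (dim_row \<Sigma>) \<and> pos_semidef \<Gamma> \<and>
        \<Psi> \<in> carrier_mat (dim_row \<Sigma>) (dim_row \<Sigma>) \<and> pos_semidef \<Psi> \<and>
        pos_semidef (four_block_mat
          \<Gamma> (l \<cdot>\<^sub>m mat_sqrt \<Sigma>)
          (l \<cdot>\<^sub>m mat_sqrt \<Sigma>) \<Psi>) \<and>
        pos_semidef (four_block_mat
          (l \<cdot>\<^sub>m 1\<^sub>m (dim_row \<Sigma>) - \<D>\<^sup>T * M_tilde \<B> \<Q> L * \<D> - \<Psi>) (\<D>\<^sup>T * L\<^sup>T)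
          (L * \<D>) (mat_inv (R_tilde \<B> \<Q> \<R>)))}"

definition sdp_value ::
  "real \<Rightarrow> real mat \<Rightarrow> real mat \<Rightarrow> real mat \<Rightarrow> real mat \<Rightarrow> real mat \<Rightarrow> real mat \<Rightarrow> ereal" where
  "sdp_value \<epsilon> \<Sigma> \<B> \<D> \<Q> \<R> L =
     (INF (l, \<Gamma>, \<Psi>) \<in> sdp_feasible \<Sigma> \<B> \<D> \<Q> \<R> L.
        ereal (l * (\<epsilon>\<^sup>2 - trace_mat \<Sigma>) + trace_mat \<Gamma>))"

end

theory Submission
  imports
    Defs
    "Jordan_Normal_Form.Determinant"
    "HOL-Computational_Algebra.Formal_Power_Series"
begin

text \<open>
  For fixed \<open>\<lambda>\<close> the semidefinite program only restates the summand
  \<open>\<lambda>\<^sup>2 tr (\<Sigma> P\<inverse>)\<close> of the dual objective, where \<open>P = \<lambda> I - \<Xi>\<close>, by means of two Schur complements.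

  Expanding \<open>\<Xi>\<close> gives \<open>\<Xi> = \<D>\<^sup>T M \<D> + (L \<D>)\<^sup>T R (L \<D>)\<close> with \<open>M\<close> and \<open>R\<close> the matrices with a
  tilde (\<open>Xi_eq\<close>).  Since \<open>R\<close> is positive definite, the second matrix inequality is therefore
  equivalent to \<open>\<Psi> \<preceq> P\<close> (\<open>cost_lmi_iff\<close>).  For positive definite \<open>\<Psi>\<close> the first matrix inequality
  means \<open>\<lambda>\<^sup>2 S \<Psi>\<inverse> S \<preceq> \<Gamma>\<close> with \<open>S = \<Sigma>\<^bsup>1/2\<^esup>\<close> (\<open>pos_semidef_schur_complement\<close>).

  If \<open>P\<close> is positive definite, then \<open>\<lambda> > 0\<close> because \<open>\<Xi>\<close> is positive semidefinite, and
  \<open>\<Psi> = P\<close>, \<open>\<Gamma> = \<lambda>\<^sup>2 S P\<inverse> S\<close> is a feasible point with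
  the same objective value (\<open>sdp_value_le_dual_objective\<close>).  Conversely, let
  \<open>(\<lambda>, \<Gamma>, \<Psi>)\<close> be feasible.  As \<open>\<Psi> \<preceq> P\<close>, the first inequality persists with \<open>P\<close> in place of
  \<open>\<Psi>\<close>.  If \<open>\<lambda> > 0\<close>, then the off-diagonal block \<open>\<lambda> S\<close> is injective, which forces \<open>P\<close> to be positive
  definite, and taking traces in the Schur complement yields \<open>\<lambda>\<^sup>2 tr (\<Sigma> P\<inverse>) \<le> tr \<Gamma>\<close>.  If
  \<open>\<lambda> = 0\<close>, then \<open>- \<Xi> - \<Psi> \<succeq> 0\<close> forces \<open>\<Xi> = 0\<close>; the dual objective is then \<open>\<lambda> \<epsilon>\<^sup>2\<close>
  for every \<open>\<lambda> > 0\<close>, so that its infimum is at most \<open>0 \<le> tr \<Gamma>\<close>, although the value \<open>0\<close> is not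
  attained (\<open>dual_value_le_sdp_objective\<close>).

  Two facts make the statement meaningful in the first place.  The square root is defined by a definite
  description, so a positive semidefinite matrix has to be shown to have exactly one positive
  semidefinite square root (\<open>mat_sqrt\<close>); existence comes from the binomial series.  And \<open>\<B> K\<close>
  is strictly lower triangular by causality, so \<open>I - \<B> K\<close> is invertible and \<open>L\<close> has the expected
  dimensions (\<open>det_one_minus_response_gain\<close>).
\<close>

section \<open>Quadratic forms and definite matrices\<close>

lemma pos_semidef_iff:
  assumes "X \<in> carrier_mat n n"
  shows "pos_semidef X \<longleftrightarrow> X\<^sup>T = X \<and> (\<forall>x \<in> carrier_vec n. 0 \<le> x \<bullet> (X *\<^sub>v x))"
  using assms by (auto simp: pos_semidef_def)

lemma pos_def_iff:
  assumes "X \<in> carrier_mat n n"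
  shows "pos_def X \<longleftrightarrow>
    X\<^sup>T = X \<and> (\<forall>x \<in> carrier_vec n. x \<noteq> 0\<^sub>v n \<longrightarrow> 0 < x \<bullet> (X *\<^sub>v x))"
  using assms by (auto simp: pos_def_def)

lemma pos_def_imp_pos_semidef:
  assumes "X \<in> carrier_mat n n" "pos_def X"
  shows "pos_semidef X"
  unfolding pos_semidef_iff[OF assms(1)]
proof (intro conjI ballI)
  show "X\<^sup>T = X" using assms by (simp add: pos_def_def)
  fix x :: "real vec" assume x: "x \<in> carrier_vec n"
  show "0 \<le> x \<bullet> (X *\<^sub>v x)"
  proof (cases "x = 0\<^sub>v n")
    case True
    then show ?thesis using assms(1) by simp
  next
    case False
    then show ?thesis using assms x by (auto simp: pos_def_iff[OF assms(1)] intro: less_imp_le)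
  qed
qed

lemma pos_semidef_square:
  assumes "pos_semidef X"
  obtains n where "X \<in> carrier_mat n n"
  using assms unfolding pos_semidef_def by (metis carrier_matI index_transpose_mat(2))

lemma pos_def_square:
  assumes "pos_def X"
  obtains n where "X \<in> carrier_mat n n"
  using assms unfolding pos_def_def by (metis carrier_matI index_transpose_mat(2))

lemma scalar_prod_mult_mat_vec:
  fixes F :: "real mat"
  assumes "F \<in> carrier_mat m n" "x \<in> carrier_vec n" "y \<in> carrier_vec m"
  shows "x \<bullet> (F\<^sup>T *\<^sub>v y) = (F *\<^sub>v x) \<bullet> y"
proof -
  have "x \<bullet> (F\<^sup>T *\<^sub>v y) = (F\<^sup>T *\<^sub>v y) \<bullet> x"
    using assms by (intro comm_scalar_prod[of _ n]) auto
  also have "\<dots> = y \<bullet> (F *\<^sub>v x)"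
    using assms by (intro transpose_vec_mult_scalar) auto
  also have "\<dots> = (F *\<^sub>v x) \<bullet> y"
    using assms by (intro comm_scalar_prod[of _ m]) auto
  finally show ?thesis .
qed

lemma symmetric_scalar_prod:
  fixes X :: "real mat"
  assumes "X \<in> carrier_mat n n" "X\<^sup>T = X" "x \<in> carrier_vec n" "y \<in> carrier_vec n"
  shows "x \<bullet> (X *\<^sub>v y) = (X *\<^sub>v x) \<bullet> y"
  using scalar_prod_mult_mat_vec[of X n n x y] assms by simp

lemma scalar_prod_self_nonneg: "0 \<le> x \<bullet> (x :: real vec)"
  by (auto simp: scalar_prod_def intro: sum_nonneg)

lemma scalar_prod_self_eq_0D:
  assumes "x \<bullet> (x :: real vec) = 0" "x \<in> carrier_vec n"
  shows "x = 0\<^sub>v n"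
proof (rule eq_vecI)
  fix i assume i: "i < dim_vec (0\<^sub>v n :: real vec)"
  have "\<forall>i\<in>{0..<dim_vec x}. x $ i * x $ i = 0"
    using assms(1) unfolding scalar_prod_def by (subst (asm) sum_nonneg_eq_0_iff) auto
  then show "x $ i = 0\<^sub>v n $ i" using i assms(2) by auto
qed (use assms in auto)

lemma smult_mat_mult_vec:
  fixes X :: "real mat"
  assumes "X \<in> carrier_mat n m" "x \<in> carrier_vec m"
  shows "(c \<cdot>\<^sub>m X) *\<^sub>v x = c \<cdot>\<^sub>v (X *\<^sub>v x)"
  using assms by (intro eq_vecI) auto

lemma zero_mat_mult_vec [simp]:
  fixes x :: "real vec"
  assumes "x \<in> carrier_vec m"
  shows "0\<^sub>m n m *\<^sub>v x = 0\<^sub>v n"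
  using assms by (intro eq_vecI) auto

lemma pos_semidef_zero: "pos_semidef (0\<^sub>m n n)"
  by (auto simp: pos_semidef_def)

lemma mult_mat_unit_vec:
  fixes X :: "real mat"
  assumes "X \<in> carrier_mat n m" "j < m"
  shows "X *\<^sub>v unit_vec m j = col X j"
  using assms by (intro eq_vecI) auto

lemma mat_eq_if_mult_unit_vec_eq:
  fixes X Y :: "real mat"
  assumes "X \<in> carrier_mat n n" "Y \<in> carrier_mat n n"
    and "\<And>j. j < n \<Longrightarrow> X *\<^sub>v unit_vec n j = Y *\<^sub>v unit_vec n j"
  shows "X = Y"
  using assms by (intro mat_col_eqI) (auto simp: mult_mat_unit_vec[of _ n n])

lemma pos_def_smult_one: "0 < c \<Longrightarrow> pos_def (c \<cdot>\<^sub>m 1\<^sub>m n)"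
proof -
  assume c: "0 < c"
  have m: "c \<cdot>\<^sub>m 1\<^sub>m n \<in> carrier_mat n n" by simp
  have "0 < x \<bullet> x" if "x \<in> carrier_vec n" "x \<noteq> 0\<^sub>v n" for x :: "real vec"
    using that scalar_prod_self_nonneg[of x] scalar_prod_self_eq_0D[of x n] by force
  then show ?thesis
    using c unfolding pos_def_iff[OF m]
    by (auto simp: smult_mat_mult_vec[of _ n n] intro!: eq_matI)
qed

lemma quadratic_form_sum:
  fixes X :: "real mat"
  assumes "X \<in> carrier_mat n n" "x \<in> carrier_vec n"
  shows "x \<bullet> (X *\<^sub>v x) = (\<Sum>i<n. \<Sum>j<n. x $ i * x $ j * X $$ (i, j))"
  using assms
  by (simp add: scalar_prod_def sum_distrib_left atLeast0LessThan algebra_simps)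

lemma quadratic_form_unit_vec:
  fixes X :: "real mat"
  assumes "X \<in> carrier_mat n n" "j < n"
  shows "unit_vec n j \<bullet> (X *\<^sub>v unit_vec n j) = X $$ (j, j)"
  using assms by (simp add: mult_mat_unit_vec[of _ n n])

lemma diagonal_nonneg:
  assumes "X \<in> carrier_mat n n" "pos_semidef X" "j < n"
  shows "0 \<le> X $$ (j, j)"
  using assms by (metis pos_semidef_iff quadratic_form_unit_vec unit_vec_carrier)

lemma pos_semidef_smult:
  assumes "X \<in> carrier_mat n n" "pos_semidef X" "0 \<le> c"
  shows "pos_semidef (c \<cdot>\<^sub>m X)"
proof -
  have c: "c \<cdot>\<^sub>m X \<in> carrier_mat n n" using assms by simp
  have "(c \<cdot>\<^sub>m X)\<^sup>T = c \<cdot>\<^sub>m X\<^sup>T" by (rule eq_matI) auto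
  then have t: "(c \<cdot>\<^sub>m X)\<^sup>T = c \<cdot>\<^sub>m X"
    using assms by (simp add: pos_semidef_def)
  have "x \<bullet> ((c \<cdot>\<^sub>m X) *\<^sub>v x) = c * (x \<bullet> (X *\<^sub>v x))" if "x \<in> carrier_vec n" for x
    using assms(1) that by (simp add: smult_mat_mult_vec[of _ n n])
  then show ?thesis
    using assms t by (auto simp: pos_semidef_iff[OF c] pos_semidef_iff[OF assms(1)])
qed

lemma pos_semidef_add:
  assumes "X \<in> carrier_mat n n" "Y \<in> carrier_mat n n" "pos_semidef X" "pos_semidef Y"
  shows "pos_semidef (X + Y)"
proof -
  have c: "X + Y \<in> carrier_mat n n" using assms by simp
  have t: "(X + Y)\<^sup>T = X + Y"
    using assms by (auto simp: pos_semidef_def transpose_add[of X n n])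
  have "x \<bullet> ((X + Y) *\<^sub>v x) = x \<bullet> (X *\<^sub>v x) + x \<bullet> (Y *\<^sub>v x)"
    if "x \<in> carrier_vec n" for x
    using assms(1,2) that
    by (simp add: add_mult_distrib_mat_vec[of _ n n] scalar_prod_add_distrib[of _ n])
  then show ?thesis
    using assms t by (auto simp: pos_semidef_iff[OF c] pos_semidef_iff[OF assms(1)] pos_semidef_iff[OF assms(2)])
qed

lemma quadratic_form_minus:
  fixes X Y :: "real mat"
  assumes "X \<in> carrier_mat n n" "Y \<in> carrier_mat n n" "x \<in> carrier_vec n"
  shows "x \<bullet> ((X - Y) *\<^sub>v x) = x \<bullet> (X *\<^sub>v x) - x \<bullet> (Y *\<^sub>v x)"
  using assms
  by (simp add: minus_mult_distrib_mat_vec[of _ n n] scalar_prod_minus_distrib[of _ n])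

lemma quadratic_form_congruence:
  fixes X F :: "real mat"
  assumes "X \<in> carrier_mat m m" "F \<in> carrier_mat m n" "x \<in> carrier_vec n"
  shows "x \<bullet> ((F\<^sup>T * X * F) *\<^sub>v x) = (F *\<^sub>v x) \<bullet> (X *\<^sub>v (F *\<^sub>v x))"
proof -
  have "(F\<^sup>T * X * F) *\<^sub>v x = F\<^sup>T *\<^sub>v (X *\<^sub>v (F *\<^sub>v x))"
    using assms by (simp add: assoc_mult_mat_vec[of _ n m _ n] assoc_mult_mat_vec[of _ n m _ m])
  then show ?thesis
    using assms by (simp add: scalar_prod_mult_mat_vec[of F m n])
qed

lemma symmetric_congruence:
  fixes X F :: "real mat"
  assumes "X \<in> carrier_mat m m" "F \<in> carrier_mat m n" "X\<^sup>T = X"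
  shows "(F\<^sup>T * X * F)\<^sup>T = F\<^sup>T * X * F"
proof -
  have "(F\<^sup>T * X * F)\<^sup>T = F\<^sup>T * (F\<^sup>T * X)\<^sup>T"
    using assms by (intro transpose_mult[of _ n m]) auto
  also have "(F\<^sup>T * X)\<^sup>T = X\<^sup>T * F"
    using assms transpose_mult[of "F\<^sup>T" n m X m] by simp
  finally show ?thesis using assms by simp
qed

lemma pos_semidef_congruence:
  assumes "X \<in> carrier_mat m m" "F \<in> carrier_mat m n" "pos_semidef X"
  shows "pos_semidef (F\<^sup>T * X * F)"
proof -
  have c: "F\<^sup>T * X * F \<in> carrier_mat n n" using assms by simp
  show ?thesis
    unfolding pos_semidef_iff[OF c]
  proof (intro conjI ballI)
    show "(F\<^sup>T * X * F)\<^sup>T = F\<^sup>T * X * F"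
      using symmetric_congruence[OF assms(1,2)] assms(3) by (simp add: pos_semidef_def)
    fix x :: "real vec" assume x: "x \<in> carrier_vec n"
    have "F *\<^sub>v x \<in> carrier_vec m" using assms x by simp
    then show "0 \<le> x \<bullet> ((F\<^sup>T * X * F) *\<^sub>v x)"
      using assms(3) quadratic_form_congruence[OF assms(1,2) x]
      by (auto simp: pos_semidef_iff[OF assms(1)])
  qed
qed

text \<open>
  A positive semidefinite form that vanishes at \<open>x\<close> is minimal there, so its gradient \<open>2 X x\<close>
  vanishes; the proof moves from \<open>x\<close> a little in the direction opposite to \<open>X x\<close>.
\<close>

lemma pos_semidef_quadratic_form_eq_0D:
  assumes "X \<in> carrier_mat n n" "pos_semidef X" "x \<in> carrier_vec n" "x \<bullet> (X *\<^sub>v x) = 0"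
  shows "X *\<^sub>v x = 0\<^sub>v n"
proof -
  define y where "y = X *\<^sub>v x"
  have y: "y \<in> carrier_vec n" using assms by (simp add: y_def)
  have sym: "X\<^sup>T = X" using assms(2) by (simp add: pos_semidef_def)
  have xy: "x \<bullet> (X *\<^sub>v y) = y \<bullet> y"
    using symmetric_scalar_prod[OF assms(1) sym assms(3) y] by (simp add: y_def)
  have yx: "y \<bullet> (X *\<^sub>v x) = y \<bullet> y" by (simp add: y_def)
  have expand: "0 \<le> 2 * t * (y \<bullet> y) + t\<^sup>2 * (y \<bullet> (X *\<^sub>v y))" for t
  proof -
    have v: "x + t \<cdot>\<^sub>v y \<in> carrier_vec n" using assms y by simp
    have "X *\<^sub>v (x + t \<cdot>\<^sub>v y) = X *\<^sub>v x + t \<cdot>\<^sub>v (X *\<^sub>v y)"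
      using assms y by (simp add: mult_add_distrib_mat_vec[of _ n n] mult_mat_vec[of _ n n])
    then have "(x + t \<cdot>\<^sub>v y) \<bullet> (X *\<^sub>v (x + t \<cdot>\<^sub>v y))
        = x \<bullet> (X *\<^sub>v x) + t * (x \<bullet> (X *\<^sub>v y)) + (t * (y \<bullet> (X *\<^sub>v x)) + t * (t * (y \<bullet> (X *\<^sub>v y))))"
      using assms y
      by (simp add: add_scalar_prod_distrib[of _ n] scalar_prod_add_distrib[of _ n] distrib_left)
    moreover have "0 \<le> (x + t \<cdot>\<^sub>v y) \<bullet> (X *\<^sub>v (x + t \<cdot>\<^sub>v y))"
      using assms(2) v by (auto simp: pos_semidef_iff[OF assms(1)])
    ultimately show ?thesis
      by (simp add: assms(4) xy yx power2_eq_square algebra_simps)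
  qed
  have "y \<bullet> y = 0"
  proof (rule ccontr)
    assume "y \<bullet> y \<noteq> 0"
    then have a: "0 < y \<bullet> y" using scalar_prod_self_nonneg[of y] by simp
    define b where "b = y \<bullet> (X *\<^sub>v y)"
    have b: "0 \<le> b" using assms(2) y by (auto simp: b_def pos_semidef_iff[OF assms(1)])
    \<comment> \<open>Adding \<open>1\<close> to \<open>b\<close> keeps the denominator nonzero and makes the quadratic term smaller
      than the linear one.\<close>
    define t where "t = - (y \<bullet> y) / (1 + b)"
    have tb: "t * (1 + b) = - (y \<bullet> y)" using b by (simp add: t_def)
    have t: "t < 0" using a b by (simp add: t_def divide_neg_pos)
    have "2 * t * (y \<bullet> y) + t\<^sup>2 * b = t * (2 * (y \<bullet> y) + t * (1 + b) - t)"
      by (simp add: power2_eq_square algebra_simps)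
    also have "\<dots> = t * (y \<bullet> y - t)" by (simp add: tb)
    also have "\<dots> < 0" using t a by (intro mult_neg_pos) auto
    finally show False using expand[of t] by (simp add: b_def)
  qed
  then show ?thesis using scalar_prod_self_eq_0D y by (simp add: y_def)
qed

text \<open>
  The case \<open>l = 0\<close> of the second matrix inequality: the forms of \<open>X\<close> and \<open>Y\<close> are nonnegative and add up
  to something nonpositive.
\<close>

lemma neg_pos_semidef_imp_zero:
  assumes X: "X \<in> carrier_mat n n" "pos_semidef X" and Y: "Y \<in> carrier_mat n n" "pos_semidef Y"
    and le: "pos_semidef (0 \<cdot>\<^sub>m 1\<^sub>m n - X - Y)"
  shows "X = 0\<^sub>m n n"
proof (rule mat_eq_if_mult_unit_vec_eq[OF X(1)])
  fix j assume j: "j < n"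
  define e where "e = (unit_vec n j :: real vec)"
  have e: "e \<in> carrier_vec n" by (simp add: e_def)
  have Z: "0 \<cdot>\<^sub>m 1\<^sub>m n - X \<in> carrier_mat n n" using X(1) by (rule minus_carrier_mat)
  have ZY: "0 \<cdot>\<^sub>m 1\<^sub>m n - X - Y \<in> carrier_mat n n" using Y(1) by (rule minus_carrier_mat)
  have "0 \<le> e \<bullet> ((0 \<cdot>\<^sub>m 1\<^sub>m n - X - Y) *\<^sub>v e)" using le e unfolding pos_semidef_iff[OF ZY] by blast
  also have "\<dots> = e \<bullet> ((0 \<cdot>\<^sub>m 1\<^sub>m n) *\<^sub>v e) - e \<bullet> (X *\<^sub>v e) - e \<bullet> (Y *\<^sub>v e)"
    unfolding quadratic_form_minus[OF Z Y(1) e]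
    by (subst quadratic_form_minus[OF _ X(1) e]) auto
  also have "e \<bullet> ((0 \<cdot>\<^sub>m 1\<^sub>m n) *\<^sub>v e) = 0"
    using e by (simp add: smult_mat_mult_vec[of _ n n])
  finally have "e \<bullet> (X *\<^sub>v e) + e \<bullet> (Y *\<^sub>v e) \<le> 0" by simp
  moreover have "0 \<le> e \<bullet> (X *\<^sub>v e)" using X(2) e unfolding pos_semidef_iff[OF X(1)] by blast
  moreover have "0 \<le> e \<bullet> (Y *\<^sub>v e)" using Y(2) e unfolding pos_semidef_iff[OF Y(1)] by blast
  ultimately have "X *\<^sub>v e = 0\<^sub>v n"
    using pos_semidef_quadratic_form_eq_0D[OF X e] by simp
  then show "X *\<^sub>v unit_vec n j = 0\<^sub>m n n *\<^sub>v unit_vec n j"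
    by (simp add: e_def)
qed simp

section \<open>Traces\<close>

lemma trace_mat_comm:
  assumes "X \<in> carrier_mat n m" "Y \<in> carrier_mat m n"
  shows "trace_mat (X * Y) = trace_mat (Y * X)"
  using assms
  by (simp add: trace_mat_def scalar_prod_def atLeast0LessThan sum.swap[of _ "{..<n}"] mult.commute)

lemma trace_mat_add:
  assumes "X \<in> carrier_mat n n" "Y \<in> carrier_mat n n"
  shows "trace_mat (X + Y) = trace_mat X + trace_mat Y"
  using assms by (simp add: trace_mat_def sum.distrib)

lemma trace_mat_minus:
  assumes "X \<in> carrier_mat n n" "Y \<in> carrier_mat n n"
  shows "trace_mat (X - Y) = trace_mat X - trace_mat Y"
  using assms by (simp add: trace_mat_def sum_subtractf)

lemma trace_mat_nonneg:
  assumes "X \<in> carrier_mat n n" "pos_semidef X"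
  shows "0 \<le> trace_mat X"
  using assms diagonal_nonneg[OF assms] by (auto simp: trace_mat_def intro: sum_nonneg)

lemma trace_mat_eq_0D:
  assumes "X \<in> carrier_mat n n" "pos_semidef X" "trace_mat X = 0" "j < n"
  shows "unit_vec n j \<bullet> (X *\<^sub>v unit_vec n j) = 0"
proof -
  have "\<forall>j\<in>{..<n}. X $$ (j, j) = 0"
    using assms diagonal_nonneg[OF assms(1,2)]
    by (subst sum_nonneg_eq_0_iff[symmetric]) (auto simp: trace_mat_def)
  then show ?thesis using quadratic_form_unit_vec[OF assms(1,4)] assms(4) by simp
qed

section \<open>Inverses\<close>

lemma mat_inv_if_det_nonzero:
  assumes "X \<in> carrier_mat n n" "det X \<noteq> 0"
  shows "mat_inv X \<in> carrier_mat n n" "X * mat_inv X = 1\<^sub>m n" "mat_inv X * X = 1\<^sub>m n"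
proof -
  have "X \<in> Units (ring_mat TYPE(real) n ())"
    using det_non_zero_imp_unit[OF assms] .
  then obtain Y where "mat_inverse X = Some Y"
    using mat_inverse(1)[OF assms(1), of "()"] by (cases "mat_inverse X") auto
  then show "mat_inv X \<in> carrier_mat n n" "X * mat_inv X = 1\<^sub>m n" "mat_inv X * X = 1\<^sub>m n"
    using mat_inverse(2)[OF assms(1)] by (auto simp: mat_inv_def)
qed

lemma det_nonzero_if_pos_def:
  assumes "X \<in> carrier_mat n n" "pos_def X"
  shows "det X \<noteq> 0"
proof
  assume "det X = 0"
  then obtain v where "v \<in> carrier_vec n" "v \<noteq> 0\<^sub>v n" "X *\<^sub>v v = 0\<^sub>v n"
    using det_0_iff_vec_prod_zero[OF assms(1)] by auto
  then show False using assms by (auto simp: pos_def_iff[OF assms(1)])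
qed

lemmas mat_inv_if_pos_def = mat_inv_if_det_nonzero[OF _ det_nonzero_if_pos_def]

lemma mat_inv_eqI:
  assumes "X \<in> carrier_mat n n" "Y \<in> carrier_mat n n" "X * Y = 1\<^sub>m n"
  shows "mat_inv X = Y"
proof -
  have "det X * det Y = 1" using det_mult[OF assms(1,2)] assms(3) by simp
  then have "det X \<noteq> 0" by auto
  note inv = mat_inv_if_det_nonzero[OF assms(1) this]
  have "mat_inv X = mat_inv X * (X * Y)" using inv assms by simp
  also have "\<dots> = (mat_inv X * X) * Y" using assoc_mult_mat[OF inv(1) assms(1,2)] by (rule sym)
  also have "\<dots> = Y" unfolding inv(3) using assms by simp
  finally show ?thesis .
qed

lemma mat_inv_smult_one:
  assumes "c \<noteq> 0"
  shows "mat_inv (c \<cdot>\<^sub>m 1\<^sub>m n) = (1 / c) \<cdot>\<^sub>m 1\<^sub>m n"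
  using assms by (intro mat_inv_eqI[of _ n]) (auto intro!: eq_matI)

lemma pos_def_mat_inv:
  assumes "X \<in> carrier_mat n n" "pos_def X"
  shows "pos_def (mat_inv X)"
proof -
  note inv = mat_inv_if_pos_def[OF assms(1,1) assms(2)]
  have sym: "X\<^sup>T = X" using assms(2) by (simp add: pos_def_def)
  show ?thesis
    unfolding pos_def_iff[OF inv(1)]
  proof (intro conjI ballI impI)
    have "X * (mat_inv X)\<^sup>T = (mat_inv X * X)\<^sup>T"
      using inv assms sym by (subst transpose_mult[of _ n n]) auto
    then have "X * (mat_inv X)\<^sup>T = 1\<^sub>m n" by (simp add: inv)
    then show "(mat_inv X)\<^sup>T = mat_inv X"
      using mat_inv_eqI[OF assms(1), of "(mat_inv X)\<^sup>T"] inv by simp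
    fix x :: "real vec" assume x: "x \<in> carrier_vec n" "x \<noteq> 0\<^sub>v n"
    define y where "y = mat_inv X *\<^sub>v x"
    have y: "y \<in> carrier_vec n" using inv x by (simp add: y_def)
    have xy: "x = X *\<^sub>v y"
      using inv x assms by (simp add: y_def assoc_mult_mat_vec[of _ n n _ n, symmetric])
    with x y assms(1) have "y \<noteq> 0\<^sub>v n" by auto
    then have "0 < y \<bullet> (X *\<^sub>v y)" using assms(2) y by (auto simp: pos_def_iff[OF assms(1)])
    also have "\<dots> = x \<bullet> (mat_inv X *\<^sub>v x)"
      using comm_scalar_prod[of y n x] x y by (simp add: xy[symmetric] y_def[symmetric])
    finally show "0 < x \<bullet> (mat_inv X *\<^sub>v x)" .
  qed
qed

section \<open>Block matrices and Schur complements\<close>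

lemma ball_carrier_vec_append:
  "(\<forall>v \<in> carrier_vec (n + m). P v) \<longleftrightarrow>
   (\<forall>x \<in> carrier_vec n. \<forall>y \<in> carrier_vec m. P (x @\<^sub>v y))"
proof (intro iffI ballI)
  fix v :: "'a vec"
  assume "\<forall>x \<in> carrier_vec n. \<forall>y \<in> carrier_vec m. P (x @\<^sub>v y)" "v \<in> carrier_vec (n + m)"
  then show "P v" using vec_first_last_append[of v n m] by (metis vec_first_carrier vec_last_carrier)
qed auto

lemma quadratic_form_four_block:
  fixes A F C :: "real mat"
  assumes "A \<in> carrier_mat n n" "F \<in> carrier_mat m n" "C \<in> carrier_mat m m"
    and "x \<in> carrier_vec n" "y \<in> carrier_vec m"
  shows "(x @\<^sub>v y) \<bullet> (four_block_mat A F\<^sup>T F C *\<^sub>v (x @\<^sub>v y))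
    = x \<bullet> (A *\<^sub>v x) + 2 * ((F *\<^sub>v x) \<bullet> y) + y \<bullet> (C *\<^sub>v y)"
proof -
  have "(x @\<^sub>v y) \<bullet> (four_block_mat A F\<^sup>T F C *\<^sub>v (x @\<^sub>v y))
      = x \<bullet> (A *\<^sub>v x + F\<^sup>T *\<^sub>v y) + y \<bullet> (F *\<^sub>v x + C *\<^sub>v y)"
    using assms
    by (subst four_block_mat_mult_vec[of _ n n _ m _ m])
       (auto intro!: scalar_prod_append[of _ n _ m])
  also have "\<dots> = x \<bullet> (A *\<^sub>v x) + x \<bullet> (F\<^sup>T *\<^sub>v y) + (y \<bullet> (F *\<^sub>v x) + y \<bullet> (C *\<^sub>v y))"
    using assms by (simp add: scalar_prod_add_distrib[of _ n] scalar_prod_add_distrib[of _ m])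
  also have "x \<bullet> (F\<^sup>T *\<^sub>v y) = (F *\<^sub>v x) \<bullet> y"
    using assms by (simp add: scalar_prod_mult_mat_vec[of F m n])
  also have "y \<bullet> (F *\<^sub>v x) = (F *\<^sub>v x) \<bullet> y"
    using assms by (simp add: comm_scalar_prod[of _ m])
  finally show ?thesis by simp
qed

lemma symmetric_four_block_iff:
  fixes A F C :: "real mat"
  assumes "A \<in> carrier_mat n n" "F \<in> carrier_mat m n" "C \<in> carrier_mat m m"
  shows "(four_block_mat A F\<^sup>T F C)\<^sup>T = four_block_mat A F\<^sup>T F C \<longleftrightarrow> A\<^sup>T = A \<and> C\<^sup>T = C"
proof -
  have "(four_block_mat A F\<^sup>T F C)\<^sup>T = four_block_mat A\<^sup>T F\<^sup>T F C\<^sup>T"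
    using assms by (simp add: transpose_four_block_mat[of _ n n _ m _ m])
  moreover have "A\<^sup>T = A \<and> C\<^sup>T = C"
    if eq: "four_block_mat A\<^sup>T F\<^sup>T F C\<^sup>T = four_block_mat A F\<^sup>T F C"
  proof
    show "A\<^sup>T = A"
    proof (rule eq_matI)
      fix i j assume "i < dim_row A" "j < dim_col A"
      then show "A\<^sup>T $$ (i, j) = A $$ (i, j)"
        using arg_cong[OF eq, of "\<lambda>M. M $$ (i, j)"] assms by auto
    qed (use assms in auto)
    show "C\<^sup>T = C"
    proof (rule eq_matI)
      fix i j assume "i < dim_row C" "j < dim_col C"
      then show "C\<^sup>T $$ (i, j) = C $$ (i, j)"
        using arg_cong[OF eq, of "\<lambda>M. M $$ (n + i, n + j)"] assms by auto
    qed (use assms in auto)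
  qed
  ultimately show ?thesis by metis
qed

lemma pos_semidef_four_block_iff:
  fixes A F C :: "real mat"
  assumes "A \<in> carrier_mat n n" "F \<in> carrier_mat m n" "C \<in> carrier_mat m m"
  shows "pos_semidef (four_block_mat A F\<^sup>T F C) \<longleftrightarrow>
    A\<^sup>T = A \<and> C\<^sup>T = C \<and>
    (\<forall>x \<in> carrier_vec n. \<forall>y \<in> carrier_vec m.
       0 \<le> x \<bullet> (A *\<^sub>v x) + 2 * ((F *\<^sub>v x) \<bullet> y) + y \<bullet> (C *\<^sub>v y))"
proof -
  have c: "four_block_mat A F\<^sup>T F C \<in> carrier_mat (n + m) (n + m)"
    using assms by simp
  show ?thesis
    unfolding pos_semidef_iff[OF c] symmetric_four_block_iff[OF assms] ball_carrier_vec_append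
    using quadratic_form_four_block[OF assms] by auto
qed

text \<open>
  Completing the square in \<open>y\<close>: with \<open>g = C\<inverse> F x\<close> the form of the block matrix at \<open>(x, y)\<close> is
  the form of the Schur complement at \<open>x\<close> plus the nonnegative form of \<open>C\<close> at \<open>y + g\<close>, and the
  latter vanishes for \<open>y = - g\<close>.
\<close>

lemma pos_semidef_schur_complement:
  fixes A F C :: "real mat"
  assumes A: "A \<in> carrier_mat n n" and F: "F \<in> carrier_mat m n" and C: "C \<in> carrier_mat m m"
    and pd: "pos_def C"
  shows "pos_semidef (four_block_mat A F\<^sup>T F C) \<longleftrightarrow> pos_semidef (A - F\<^sup>T * mat_inv C * F)"
proof -
  note inv = mat_inv_if_pos_def[OF C C pd]
  define Z where "Z = F\<^sup>T * mat_inv C * F"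
  have Z: "Z \<in> carrier_mat n n" using F inv by (simp add: Z_def)
  have AZ: "A - Z \<in> carrier_mat n n" using A Z by (simp add: minus_carrier_mat)
  have symC: "C\<^sup>T = C" using pd by (simp add: pos_def_def)
  have symI: "(mat_inv C)\<^sup>T = mat_inv C"
    using pos_def_mat_inv[OF C pd] by (simp add: pos_def_def)
  have symZ: "Z\<^sup>T = Z"
    using symmetric_congruence[OF inv(1) F symI] by (simp add: Z_def)
  have sym: "(A - Z)\<^sup>T = A - Z \<longleftrightarrow> A\<^sup>T = A"
  proof
    assume eq: "(A - Z)\<^sup>T = A - Z"
    have "A\<^sup>T = ((A - Z) + Z)\<^sup>T" using A Z by (intro arg_cong[of _ _ transpose_mat] eq_matI) auto
    also have "\<dots> = (A - Z) + Z" using AZ Z eq symZ by (simp add: transpose_add[of _ n n])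
    also have "\<dots> = A" using A Z by (intro eq_matI) auto
    finally show "A\<^sup>T = A" .
  next
    assume "A\<^sup>T = A"
    then show "(A - Z)\<^sup>T = A - Z" using A Z symZ by (simp add: transpose_minus[of _ n n])
  qed
  have square: "x \<bullet> (A *\<^sub>v x) + 2 * ((F *\<^sub>v x) \<bullet> y) + y \<bullet> (C *\<^sub>v y)
      = x \<bullet> ((A - Z) *\<^sub>v x) + (y + g) \<bullet> (C *\<^sub>v (y + g))"
    if x: "x \<in> carrier_vec n" and y: "y \<in> carrier_vec m" and g_def: "g = mat_inv C *\<^sub>v (F *\<^sub>v x)" for x y g
  proof -
    have g: "g \<in> carrier_vec m" using inv F x g_def by simp
    have Fx: "F *\<^sub>v x \<in> carrier_vec m" using F x by simp
    have Cg: "C *\<^sub>v g = F *\<^sub>v x"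
      using inv C F x by (simp add: g_def assoc_mult_mat_vec[of _ m m _ m, symmetric])
    have "x \<bullet> ((A - Z) *\<^sub>v x) = x \<bullet> (A *\<^sub>v x) - (F *\<^sub>v x) \<bullet> g"
      using quadratic_form_minus[OF A Z x] quadratic_form_congruence[OF inv(1) F x]
      by (simp add: Z_def g_def)
    moreover have "(y + g) \<bullet> (C *\<^sub>v (y + g))
        = y \<bullet> (C *\<^sub>v y) + y \<bullet> (F *\<^sub>v x) + (g \<bullet> (C *\<^sub>v y) + g \<bullet> (F *\<^sub>v x))"
      using C y g Fx
      by (simp add: mult_add_distrib_mat_vec[of _ m m] add_scalar_prod_distrib[of _ m]
          scalar_prod_add_distrib[of _ m] Cg)
    moreover have "g \<bullet> (C *\<^sub>v y) = (F *\<^sub>v x) \<bullet> y"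
      using symmetric_scalar_prod[OF C symC g y] Cg by simp
    moreover have "y \<bullet> (F *\<^sub>v x) = (F *\<^sub>v x) \<bullet> y" "g \<bullet> (F *\<^sub>v x) = (F *\<^sub>v x) \<bullet> g"
      using y g Fx by (auto intro: comm_scalar_prod)
    ultimately show ?thesis by simp
  qed
  have "(\<forall>x \<in> carrier_vec n. \<forall>y \<in> carrier_vec m.
      0 \<le> x \<bullet> (A *\<^sub>v x) + 2 * ((F *\<^sub>v x) \<bullet> y) + y \<bullet> (C *\<^sub>v y)) \<longleftrightarrow>
    (\<forall>x \<in> carrier_vec n. 0 \<le> x \<bullet> ((A - Z) *\<^sub>v x))" (is "?L \<longleftrightarrow> ?R")
  proof
    assume L: ?L
    show ?R
    proof
      fix x :: "real vec" assume x: "x \<in> carrier_vec n"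
      define g where "g = mat_inv C *\<^sub>v (F *\<^sub>v x)"
      have g: "g \<in> carrier_vec m" using inv F x g_def by simp
      have "- g + g = 0\<^sub>v m" using g by simp
      then show "0 \<le> x \<bullet> ((A - Z) *\<^sub>v x)"
        using L x square[OF x _ g_def, of "- g"] g C by (metis add.right_neutral mult_mat_vec_carrier scalar_prod_left_zero uminus_carrier_vec zero_carrier_vec)
    qed
  next
    assume R: ?R
    show ?L
    proof (intro ballI)
      fix x y :: "real vec" assume x: "x \<in> carrier_vec n" and y: "y \<in> carrier_vec m"
      define g where "g = mat_inv C *\<^sub>v (F *\<^sub>v x)"
      have "y + g \<in> carrier_vec m" using inv F x y g_def by simp
      then have "0 \<le> (y + g) \<bullet> (C *\<^sub>v (y + g))"
        using pos_def_imp_pos_semidef[OF C pd] by (auto simp: pos_semidef_iff[OF C])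
      then show "0 \<le> x \<bullet> (A *\<^sub>v x) + 2 * ((F *\<^sub>v x) \<bullet> y) + y \<bullet> (C *\<^sub>v y)"
        using R x square[OF x y g_def] by auto
    qed
  qed
  then show ?thesis
    unfolding pos_semidef_four_block_iff[OF A F C] Z_def[symmetric] pos_semidef_iff[OF AZ] sym
    using symC by auto
qed

lemma pos_semidef_four_block_mono:
  fixes A F C C' :: "real mat"
  assumes A: "A \<in> carrier_mat n n" and F: "F \<in> carrier_mat m n"
    and C: "C \<in> carrier_mat m m" and C': "C' \<in> carrier_mat m m"
    and psd: "pos_semidef (four_block_mat A F\<^sup>T F C)" and le: "pos_semidef (C' - C)"
  shows "pos_semidef (four_block_mat A F\<^sup>T F C')"
proof -
  have d: "C' - C \<in> carrier_mat m m" using C by (rule minus_carrier_mat)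
  have "C' = C + (C' - C)" using C C' by (intro eq_matI) auto
  moreover have "(C + (C' - C))\<^sup>T = C + (C' - C)"
    using psd le C d unfolding pos_semidef_four_block_iff[OF A F C]
    by (simp add: transpose_add[OF C d] pos_semidef_def)
  ultimately have "C'\<^sup>T = C'" by simp
  moreover have "y \<bullet> (C *\<^sub>v y) \<le> y \<bullet> (C' *\<^sub>v y)" if "y \<in> carrier_vec m" for y
    using le that quadratic_form_minus[OF C' C that] unfolding pos_semidef_iff[OF d] by auto
  ultimately show ?thesis
    using psd unfolding pos_semidef_four_block_iff[OF A F C] pos_semidef_four_block_iff[OF A F C']
    by (smt (verit))
qed

text \<open>
  If \<open>y\<close> were a zero of the form of \<open>C\<close>, then \<open>(0, y)\<close> would be one of the form of the block matrix
  and so lie in its kernel, whose first component reads \<open>F\<^sup>T y = 0\<close>.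
\<close>

lemma pos_def_if_pos_semidef_four_block:
  fixes A F C :: "real mat"
  assumes A: "A \<in> carrier_mat n n" and F: "F \<in> carrier_mat m n" and C: "C \<in> carrier_mat m m"
    and psd: "pos_semidef (four_block_mat A F\<^sup>T F C)"
    and inj: "\<And>y. y \<in> carrier_vec m \<Longrightarrow> F\<^sup>T *\<^sub>v y = 0\<^sub>v n \<Longrightarrow> y = 0\<^sub>v m"
  shows "pos_def C"
  unfolding pos_def_iff[OF C]
proof (intro conjI ballI impI)
  show "C\<^sup>T = C" using psd unfolding pos_semidef_four_block_iff[OF A F C] by blast
  fix y :: "real vec" assume y: "y \<in> carrier_vec m" "y \<noteq> 0\<^sub>v m"
  let ?M = "four_block_mat A F\<^sup>T F C"
  have M: "?M \<in> carrier_mat (n + m) (n + m)" using A C by simp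
  have zy: "0\<^sub>v n @\<^sub>v y \<in> carrier_vec (n + m)" using y by simp
  have A0: "A *\<^sub>v 0\<^sub>v n = 0\<^sub>v n" and F0: "F *\<^sub>v 0\<^sub>v n = 0\<^sub>v m"
    using A F by (auto intro!: eq_vecI)
  have quad: "(0\<^sub>v n @\<^sub>v y) \<bullet> (?M *\<^sub>v (0\<^sub>v n @\<^sub>v y)) = y \<bullet> (C *\<^sub>v y)"
    unfolding quadratic_form_four_block[OF A F C zero_carrier_vec y(1)] A0 F0 using y by simp
  have "0 \<le> y \<bullet> (C *\<^sub>v y)"
    using psd zy unfolding quad[symmetric] pos_semidef_iff[OF M] by blast
  moreover have "y \<bullet> (C *\<^sub>v y) \<noteq> 0"
  proof
    assume "y \<bullet> (C *\<^sub>v y) = 0"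
    then have "?M *\<^sub>v (0\<^sub>v n @\<^sub>v y) = 0\<^sub>v (n + m)"
      using pos_semidef_quadratic_form_eq_0D[OF M psd zy] quad by simp
    moreover have "?M *\<^sub>v (0\<^sub>v n @\<^sub>v y) = (F\<^sup>T *\<^sub>v y) @\<^sub>v (C *\<^sub>v y)"
      using F C y
      by (subst four_block_mat_mult_vec[OF A transpose_carrier_mat[THEN iffD2, OF F] F C zero_carrier_vec y(1)])
         (simp add: A0 F0)
    ultimately have eq: "(F\<^sup>T *\<^sub>v y) @\<^sub>v (C *\<^sub>v y) = 0\<^sub>v (n + m)" by simp
    have "F\<^sup>T *\<^sub>v y = 0\<^sub>v n"
    proof (rule eq_vecI)
      fix i assume "i < dim_vec (0\<^sub>v n :: real vec)"
      then show "(F\<^sup>T *\<^sub>v y) $ i = 0\<^sub>v n $ i"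
        using arg_cong[OF eq, of "\<lambda>v. v $ i"] F by simp
    qed (use F in simp)
    then show False using inj y by blast
  qed
  ultimately show "0 < y \<bullet> (C *\<^sub>v y)" by simp
qed

lemma trace_mat_schur_complement_le:
  fixes A F C :: "real mat"
  assumes A: "A \<in> carrier_mat n n" and F: "F \<in> carrier_mat m n" and C: "C \<in> carrier_mat m m"
    and pd: "pos_def C" and psd: "pos_semidef (four_block_mat A F\<^sup>T F C)"
  shows "trace_mat (F\<^sup>T * mat_inv C * F) \<le> trace_mat A"
proof -
  have Z: "F\<^sup>T * mat_inv C * F \<in> carrier_mat n n"
    using F mat_inv_if_pos_def(1)[OF C C pd] by simp
  have "0 \<le> trace_mat (A - F\<^sup>T * mat_inv C * F)"
    using psd unfolding pos_semidef_schur_complement[OF A F C pd]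
    by (rule trace_mat_nonneg[OF minus_carrier_mat[OF Z]])
  also have "\<dots> = trace_mat A - trace_mat (F\<^sup>T * mat_inv C * F)"
    by (rule trace_mat_minus[OF A Z])
  finally show ?thesis by simp
qed

lemma pos_semidef_block_diagonal:
  assumes "A \<in> carrier_mat n n" "pos_semidef A" "C \<in> carrier_mat m m" "pos_semidef C"
  shows "pos_semidef (four_block_mat A (0\<^sub>m n m) (0\<^sub>m m n) C)"
  using assms pos_semidef_four_block_iff[of A n "0\<^sub>m m n" m C]
  by (auto simp: pos_semidef_iff[OF assms(1)] pos_semidef_iff[OF assms(3)])

lemma pos_def_block_diagonal:
  assumes "A \<in> carrier_mat n n" "pos_def A" "C \<in> carrier_mat m m" "pos_def C"
  shows "pos_def (four_block_mat A (0\<^sub>m n m) (0\<^sub>m m n) C)"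
proof -
  have c: "four_block_mat A (0\<^sub>m n m) (0\<^sub>m m n) C \<in> carrier_mat (n + m) (n + m)"
    using assms by simp
  have t: "(four_block_mat A (0\<^sub>m n m) (0\<^sub>m m n) C)\<^sup>T = four_block_mat A (0\<^sub>m n m) (0\<^sub>m m n) C"
    using symmetric_four_block_iff[of A n "0\<^sub>m m n" m C] assms by (simp add: pos_def_def)
  have q: "(x @\<^sub>v y) \<bullet> (four_block_mat A (0\<^sub>m n m) (0\<^sub>m m n) C *\<^sub>v (x @\<^sub>v y))
      = x \<bullet> (A *\<^sub>v x) + y \<bullet> (C *\<^sub>v y)" if "x \<in> carrier_vec n" "y \<in> carrier_vec m" for x y
    using quadratic_form_four_block[of A n "0\<^sub>m m n" m C x y] assms that by simp
  have nz: "x \<noteq> 0\<^sub>v n \<or> y \<noteq> 0\<^sub>v m" if "x @\<^sub>v y \<noteq> 0\<^sub>v (n + m)" for x y :: "real vec"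
  proof (rule ccontr)
    assume "\<not> (x \<noteq> 0\<^sub>v n \<or> y \<noteq> 0\<^sub>v m)"
    then have "x @\<^sub>v y = 0\<^sub>v (n + m)" by (intro eq_vecI) auto
    then show False using that by simp
  qed
  show ?thesis
    unfolding pos_def_iff[OF c] ball_carrier_vec_append
  proof (intro conjI ballI impI t)
    fix x y :: "real vec"
    assume x: "x \<in> carrier_vec n" and y: "y \<in> carrier_vec m" and "x @\<^sub>v y \<noteq> 0\<^sub>v (n + m)"
    then consider "x \<noteq> 0\<^sub>v n" | "y \<noteq> 0\<^sub>v m" using nz by blast
    moreover have "0 \<le> x \<bullet> (A *\<^sub>v x)" "0 \<le> y \<bullet> (C *\<^sub>v y)"
      using pos_def_imp_pos_semidef[OF assms(1,2)] pos_def_imp_pos_semidef[OF assms(3,4)] x y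
      by (auto simp: pos_semidef_iff[OF assms(1)] pos_semidef_iff[OF assms(3)])
    ultimately have "0 < x \<bullet> (A *\<^sub>v x) + y \<bullet> (C *\<^sub>v y)"
      using assms(2,4) x y
      by cases (auto simp: pos_def_iff[OF assms(1)] pos_def_iff[OF assms(3)] intro: add_pos_nonneg add_nonneg_pos)
    then show "0 < (x @\<^sub>v y) \<bullet> (four_block_mat A (0\<^sub>m n m) (0\<^sub>m m n) C *\<^sub>v (x @\<^sub>v y))"
      using q x y by simp
  qed
qed

lemma pos_semidef_diag_block_mat:
  "(\<And>X. X \<in> set Xs \<Longrightarrow> pos_semidef X) \<Longrightarrow> pos_semidef (diag_block_mat Xs)"
proof (induction Xs)
  case Nil
  then show ?case by (simp add: pos_semidef_zero)
next
  case (Cons X Xs)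
  have pd: "pos_semidef X" "pos_semidef (diag_block_mat Xs)" using Cons by auto
  obtain n m where "X \<in> carrier_mat n n" "diag_block_mat Xs \<in> carrier_mat m m"
    using pd pos_semidef_square by metis
  then show ?case using pos_semidef_block_diagonal[OF _ pd(1) _ pd(2)] by (simp add: Let_def)
qed

lemma pos_def_diag_block_mat:
  "(\<And>X. X \<in> set Xs \<Longrightarrow> pos_def X) \<Longrightarrow> pos_def (diag_block_mat Xs)"
proof (induction Xs)
  case Nil
  show ?case by (auto simp: pos_def_def)
next
  case (Cons X Xs)
  have pd: "pos_def X" "pos_def (diag_block_mat Xs)" using Cons by auto
  obtain n m where "X \<in> carrier_mat n n" "diag_block_mat Xs \<in> carrier_mat m m"
    using pd pos_def_square by metis
  then show ?case using pos_def_block_diagonal[OF _ pd(1) _ pd(2)] by (simp add: Let_def)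
qed

lemma diag_block_mat_carrier:
  assumes "\<And>X. X \<in> set Xs \<Longrightarrow> X \<in> carrier_mat n n"
  shows "diag_block_mat Xs \<in> carrier_mat (length Xs * n) (length Xs * n)"
  using assms
proof (induction Xs)
  case (Cons X Xs)
  have "X \<in> carrier_mat n n" "diag_block_mat Xs \<in> carrier_mat (length Xs * n) (length Xs * n)"
    using Cons by auto
  then show ?case by (auto simp: Let_def)
qed simp

section \<open>The square root of a positive semidefinite matrix\<close>

text \<open>
  The coefficients of the power series of \<open>sqrt (1 - t)\<close>.
\<close>

definition sqrt_coeff :: "nat \<Rightarrow> real" where
  "sqrt_coeff k = (- 1) ^ k * (1 / 2 gchoose k)"

lemma sqrt_coeff_pochhammer: "sqrt_coeff k = pochhammer (- 1 / 2) k / fact k"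
  by (simp add: sqrt_coeff_def gbinomial_pochhammer flip: power_add mult_2 mult.assoc)

lemma sqrt_coeff_0: "sqrt_coeff 0 = 1"
  by (simp add: sqrt_coeff_def)

text \<open>
  Together with the next lemma, this sign pattern is what makes the series converge absolutely up to
  the boundary \<open>t = 1\<close> and keeps its sum nonnegative there.
\<close>

lemma sqrt_coeff_Suc_nonpos: "sqrt_coeff (Suc k) \<le> 0"
proof -
  have "0 \<le> pochhammer (1 / 2 :: real) k"
    by (intro pochhammer_nonneg) auto
  then show ?thesis
    by (simp add: sqrt_coeff_pochhammer pochhammer_rec divide_nonpos_nonneg)
qed

text \<open>
  The partial sums telescope by Pascal's rule into the coefficients of \<open>(1 - t) powr (- 1 / 2)\<close>.
\<close>

lemma sum_sqrt_coeff_nonneg: "0 \<le> (\<Sum>k\<le>n. sqrt_coeff k)"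
proof -
  have "(\<Sum>k\<le>n. sqrt_coeff k) = (- 1) ^ n * (- (1 / 2) gchoose n)"
    using gbinomial_sum_lower_neg[of "1 / 2 :: real" n] by (simp add: sqrt_coeff_def mult.commute)
  also have "\<dots> = pochhammer (1 / 2) n / fact n"
    by (simp add: gbinomial_pochhammer flip: power_add mult_2 mult.assoc)
  also have "\<dots> \<ge> 0"
    by (intro divide_nonneg_nonneg pochhammer_nonneg) auto
  finally show ?thesis .
qed

lemma summable_abs_sqrt_coeff: "summable (\<lambda>k. \<bar>sqrt_coeff k\<bar>)"
proof (rule bounded_imp_summable)
  fix n
  \<comment> \<open>Only the coefficient \<open>1\<close> at \<open>k = 0\<close> is positive, so flipping all signs costs \<open>2\<close>.\<close>
  have "(\<Sum>k\<le>n. \<bar>sqrt_coeff k\<bar>) = (\<Sum>k\<le>n. (if k = 0 then 2 else 0) - sqrt_coeff k)"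
  proof (rule sum.cong)
    fix k
    show "\<bar>sqrt_coeff k\<bar> = (if k = 0 then 2 else 0) - sqrt_coeff k"
      using sqrt_coeff_Suc_nonpos by (cases k) (auto simp: sqrt_coeff_0 abs_of_nonpos)
  qed simp
  also have "\<dots> \<le> 2"
    using sum_sqrt_coeff_nonneg[of n] by (simp add: sum_subtractf)
  finally show "(\<Sum>k\<le>n. \<bar>sqrt_coeff k\<bar>) \<le> 2" .
qed simp

text \<open>
  The square of the series is \<open>1 - t\<close>; the right-hand side is the binomial form of its
  coefficients.
\<close>

lemma sqrt_coeff_convolution:
  "(\<Sum>i\<le>k. sqrt_coeff i * sqrt_coeff (k - i)) = (- 1) ^ k * real (1 choose k)"
proof -
  have "(\<Sum>i\<le>k. sqrt_coeff i * sqrt_coeff (k - i))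
      = (\<Sum>i\<le>k. (- 1) ^ k * ((1 / 2 gchoose i) * (1 / 2 gchoose (k - i))))"
  proof (rule sum.cong)
    fix i assume "i \<in> {..k}"
    then have "(- 1 :: real) ^ i * (- 1) ^ (k - i) = (- 1) ^ k" by (simp flip: power_add)
    then show "sqrt_coeff i * sqrt_coeff (k - i)
        = (- 1) ^ k * ((1 / 2 gchoose i) * (1 / 2 gchoose (k - i)))"
      by (simp add: sqrt_coeff_def algebra_simps)
  qed simp
  also have "\<dots> = (- 1) ^ k * (1 gchoose k)"
    using gbinomial_Vandermonde[of "1 / 2 :: real" "1 / 2" k]
    by (simp add: sum_distrib_left[symmetric] atMost_atLeast0)
  finally show ?thesis using binomial_gbinomial[of 1 k, where 'a = real] by simp
qed

lemma pow_mat_add: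
  fixes X :: "real mat"
  assumes "X \<in> carrier_mat n n"
  shows "X ^\<^sub>m (j + k) = X ^\<^sub>m j * X ^\<^sub>m k"
proof (induction k)
  case (Suc k)
  then show ?case using assms by (simp add: assoc_mult_mat[of _ n n _ n _ n])
qed (use assms in simp)

lemma pow_mat_transpose:
  fixes X :: "real mat"
  assumes "X \<in> carrier_mat n n" "X\<^sup>T = X"
  shows "(X ^\<^sub>m k)\<^sup>T = X ^\<^sub>m k"
proof (induction k)
  case (Suc k)
  have "(X ^\<^sub>m Suc k)\<^sup>T = X * X ^\<^sub>m k"
    using assms Suc by (simp add: transpose_mult[of _ n n])
  then show ?case using pow_mat_add[OF assms(1), of 1 k] assms by simp
qed (use assms in simp)

text \<open>
  The first inequality is \<open>X\<^sup>2 \<preceq> X\<close>.  It follows from the identity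
  \<open>X - X\<^sup>2 = X (I - X) X + (I - X) X (I - X)\<close>, whose two summands are the quadratic forms of
  \<open>I - X\<close> at \<open>u = X x\<close> and of \<open>X\<close> at \<open>x - u\<close>.
\<close>

lemma contraction_mult_mat_vec_le:
  assumes "X \<in> carrier_mat n n" "pos_semidef X" "pos_semidef (1\<^sub>m n - X)" "x \<in> carrier_vec n"
  shows "(X *\<^sub>v x) \<bullet> (X *\<^sub>v x) \<le> x \<bullet> (X *\<^sub>v x)" "x \<bullet> (X *\<^sub>v x) \<le> x \<bullet> x"
proof -
  define u where "u = X *\<^sub>v x"
  have u: "u \<in> carrier_vec n" using assms by (simp add: u_def)
  have c: "1\<^sub>m n - X \<in> carrier_mat n n" using assms by (simp add: minus_carrier_mat)
  have sym: "X\<^sup>T = X" using assms by (simp add: pos_semidef_def)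
  have le: "y \<bullet> (X *\<^sub>v y) \<le> y \<bullet> y" if "y \<in> carrier_vec n" for y
    using assms(3) that quadratic_form_minus[of "1\<^sub>m n" n X y] assms(1)
    by (auto simp: pos_semidef_iff[OF c])
  show "x \<bullet> (X *\<^sub>v x) \<le> x \<bullet> x" using le assms by blast
  have Xu: "x \<bullet> (X *\<^sub>v u) = u \<bullet> u"
    using symmetric_scalar_prod[OF assms(1) sym assms(4) u] by (simp add: u_def)
  have xu: "u \<bullet> (X *\<^sub>v x) = u \<bullet> u" by (simp add: u_def)
  have "0 \<le> (x - u) \<bullet> (X *\<^sub>v (x - u))"
    using assms u by (auto simp: pos_semidef_iff[OF assms(1)])
  also have "\<dots> = x \<bullet> (X *\<^sub>v x) - x \<bullet> (X *\<^sub>v u) - (u \<bullet> (X *\<^sub>v x) - u \<bullet> (X *\<^sub>v u))"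
    using assms u
    by (simp add: mult_minus_distrib_mat_vec[of _ n n] minus_scalar_prod_distrib[of _ n]
        scalar_prod_minus_distrib[of _ n])
  also have "\<dots> = x \<bullet> (X *\<^sub>v x) - 2 * (u \<bullet> u) + u \<bullet> (X *\<^sub>v u)"
    by (simp add: Xu xu)
  finally show "(X *\<^sub>v x) \<bullet> (X *\<^sub>v x) \<le> x \<bullet> (X *\<^sub>v x)"
    using le[OF u] by (simp add: u_def[symmetric])
qed

text \<open>
  Even and odd powers are treated alike by the step \<open>X ^ (k + 2) = X X ^ k X\<close>.
\<close>

lemma pow_quadratic_form_bounds:
  assumes X: "X \<in> carrier_mat n n" "pos_semidef X" "pos_semidef (1\<^sub>m n - X)"
    and "x \<in> carrier_vec n"
  shows "0 \<le> x \<bullet> (X ^\<^sub>m k *\<^sub>v x) \<and> x \<bullet> (X ^\<^sub>m k *\<^sub>v x) \<le> x \<bullet> x"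
  using assms(4)
proof (induction k arbitrary: x rule: induct_nat_012)
  case 0
  then show ?case using X scalar_prod_self_nonneg[of x] by simp
next
  case 1
  then show ?case
    using X contraction_mult_mat_vec_le[OF X 1] by (auto simp: pos_semidef_iff[OF X(1)])
next
  case (ge2 k)
  have sym: "X\<^sup>T = X" using X by (simp add: pos_semidef_def)
  have Xx: "X *\<^sub>v x \<in> carrier_vec n" using X ge2 by simp
  have "X ^\<^sub>m Suc (Suc k) = X\<^sup>T * X ^\<^sub>m k * X"
    using pow_mat_add[OF X(1), of 1 k] X sym by simp
  then have "x \<bullet> (X ^\<^sub>m Suc (Suc k) *\<^sub>v x) = (X *\<^sub>v x) \<bullet> (X ^\<^sub>m k *\<^sub>v (X *\<^sub>v x))"
    using quadratic_form_congruence[of "X ^\<^sub>m k" n X n x] X ge2 by simp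
  then show ?case
    using ge2(1)[OF Xx] contraction_mult_mat_vec_le[OF X ge2(3)] by simp
qed

text \<open>
  The entry is a coordinate of the image of a unit vector, and \<open>X\<close> does not increase norms.
\<close>

lemma pow_entry_abs_le_1:
  assumes X: "X \<in> carrier_mat n n" "pos_semidef X" "pos_semidef (1\<^sub>m n - X)"
    and ij: "i < n" "j < n"
  shows "\<bar>(X ^\<^sub>m k) $$ (i, j)\<bar> \<le> 1"
proof -
  have "(X ^\<^sub>m k *\<^sub>v v) \<bullet> (X ^\<^sub>m k *\<^sub>v v) \<le> v \<bullet> v" if "v \<in> carrier_vec n" for v
    using that
  proof (induction k arbitrary: v)
    case 0
    then show ?case using X by simp
  next
    case (Suc k)
    have Xv: "X *\<^sub>v v \<in> carrier_vec n" using X Suc by simp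
    have "X ^\<^sub>m Suc k *\<^sub>v v = X ^\<^sub>m k *\<^sub>v (X *\<^sub>v v)"
      using X Suc by (simp add: assoc_mult_mat_vec[of _ n n _ n])
    then show ?case using Suc.IH[OF Xv] contraction_mult_mat_vec_le[OF X Suc.prems] by simp
  qed
  from this[of "unit_vec n j"] have "col (X ^\<^sub>m k) j \<bullet> col (X ^\<^sub>m k) j \<le> 1"
    using X ij by (simp add: mult_mat_unit_vec[of _ n n])
  moreover have "((X ^\<^sub>m k) $$ (i, j))\<^sup>2 \<le> col (X ^\<^sub>m k) j \<bullet> col (X ^\<^sub>m k) j"
    unfolding scalar_prod_def
    using X ij member_le_sum[of i "{0..<n}" "\<lambda>l. (X ^\<^sub>m k) $$ (l, j) * (X ^\<^sub>m k) $$ (l, j)"]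
    by (auto simp: power2_eq_square)
  ultimately have "((X ^\<^sub>m k) $$ (i, j))\<^sup>2 \<le> 1" by simp
  then show ?thesis by (simp add: abs_square_le_1)
qed

text \<open>
  The square root of \<open>I - X\<close> is the binomial series of \<open>sqrt (1 - t)\<close> at \<open>X\<close>, summed entry by entry.  The
  entries of the powers are bounded, so the series converges absolutely, and Cauchy products give its square.
  It is positive semidefinite since, all coefficients but the first being nonpositive,
  replacing \<open>X ^ k\<close> by \<open>I\<close> only decreases the partial sums, which then are nonnegative multiples of
  \<open>I\<close>.
\<close>

lemma sqrt_exists_if_le_1:
  assumes X: "X \<in> carrier_mat n n" "pos_semidef X" "pos_semidef (1\<^sub>m n - X)"
  shows "\<exists>S \<in> carrier_mat n n. pos_semidef S \<and> S * S = 1\<^sub>m n - X"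
proof -
  let ?t = "\<lambda>i j k. sqrt_coeff k * (X ^\<^sub>m k) $$ (i, j)"
  define S where "S = mat n n (\<lambda>(i, j). \<Sum>k. ?t i j k)"
  have S: "S \<in> carrier_mat n n" by (simp add: S_def)
  have sym: "X\<^sup>T = X" using X by (simp add: pos_semidef_def)
  have abs: "summable (\<lambda>k. norm (?t i j k))" if "i < n" "j < n" for i j
  proof (rule summable_comparison_test'[OF summable_abs_sqrt_coeff, of 0])
    fix k
    show "norm (norm (?t i j k)) \<le> \<bar>sqrt_coeff k\<bar>"
      using pow_entry_abs_le_1[OF X that, of k] by (simp add: abs_mult mult_left_le)
  qed
  have sums: "?t i j sums S $$ (i, j)" if "i < n" "j < n" for i j
    using summable_sums[OF summable_norm_cancel[OF abs[OF that]]] that by (simp add: S_def)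
  have pow_sym: "(X ^\<^sub>m k) $$ (j, i) = (X ^\<^sub>m k) $$ (i, j)" if "i < n" "j < n" for i j k
    using arg_cong[OF pow_mat_transpose[OF X(1) sym, of k], of "\<lambda>M. M $$ (i, j)"] X that by simp
  have "S\<^sup>T = S"
    by (rule eq_matI) (auto simp: S_def pow_sym)
  moreover have "0 \<le> x \<bullet> (S *\<^sub>v x)" if x: "x \<in> carrier_vec n" for x
  proof -
    have c: "X ^\<^sub>m k \<in> carrier_mat n n" for k using X by simp
    have "(\<lambda>k. \<Sum>i<n. \<Sum>j<n. x $ i * x $ j * ?t i j k) sums (\<Sum>i<n. \<Sum>j<n. x $ i * x $ j * S $$ (i, j))"
      by (intro sums_sum sums_mult sums) auto
    moreover have "(\<Sum>i<n. \<Sum>j<n. x $ i * x $ j * ?t i j k) = sqrt_coeff k * (x \<bullet> (X ^\<^sub>m k *\<^sub>v x))" for k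
      unfolding quadratic_form_sum[OF c x] by (simp add: sum_distrib_left algebra_simps)
    ultimately have "(\<lambda>k. sqrt_coeff k * (x \<bullet> (X ^\<^sub>m k *\<^sub>v x))) sums (x \<bullet> (S *\<^sub>v x))"
      by (simp add: quadratic_form_sum[OF S x])
    then have "(\<lambda>m. \<Sum>k\<le>m. sqrt_coeff k * (x \<bullet> (X ^\<^sub>m k *\<^sub>v x))) \<longlonglongrightarrow> x \<bullet> (S *\<^sub>v x)"
      by (simp add: sums_def_le)
    then show ?thesis
    proof (rule LIMSEQ_le_const, intro exI allI impI)
      fix m :: nat
      have "0 \<le> (\<Sum>k\<le>m. sqrt_coeff k) * (x \<bullet> x)"
        using sum_sqrt_coeff_nonneg scalar_prod_self_nonneg by simp
      also have "\<dots> \<le> (\<Sum>k\<le>m. sqrt_coeff k * (x \<bullet> (X ^\<^sub>m k *\<^sub>v x)))"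
        unfolding sum_distrib_right
      proof (rule sum_mono)
        fix k
        show "sqrt_coeff k * (x \<bullet> x) \<le> sqrt_coeff k * (x \<bullet> (X ^\<^sub>m k *\<^sub>v x))"
        proof (cases k)
          case 0
          then show ?thesis using X x by simp
        next
          case (Suc l)
          then show ?thesis
            using pow_quadratic_form_bounds[OF X x, of k] sqrt_coeff_Suc_nonpos[of l]
            by (intro mult_left_mono_neg) auto
        qed
      qed
      finally show "0 \<le> (\<Sum>k\<le>m. sqrt_coeff k * (x \<bullet> (X ^\<^sub>m k *\<^sub>v x)))" .
    qed
  qed
  moreover have "S * S = 1\<^sub>m n - X"
  proof (rule eq_matI)
    fix i j assume "i < dim_row (1\<^sub>m n - X)" "j < dim_col (1\<^sub>m n - X)"
    then have ij: "i < n" "j < n" using X by auto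
    have "(\<lambda>k. \<Sum>l<n. \<Sum>p\<le>k. ?t i l p * ?t l j (k - p)) sums (\<Sum>l<n. S $$ (i, l) * S $$ (l, j))"
    proof (rule sums_sum)
      fix l assume "l \<in> {..<n}"
      then have l: "l < n" by simp
      show "(\<lambda>k. \<Sum>p\<le>k. ?t i l p * ?t l j (k - p)) sums (S $$ (i, l) * S $$ (l, j))"
        using Cauchy_product_sums[OF abs[OF ij(1) l] abs[OF l ij(2)]]
          sums_unique[OF sums[OF ij(1) l]] sums_unique[OF sums[OF l ij(2)]] by simp
    qed
    also have "(\<Sum>l<n. S $$ (i, l) * S $$ (l, j)) = (S * S) $$ (i, j)"
      using S ij by (simp add: scalar_prod_def atLeast0LessThan)
    also have "(\<lambda>k. \<Sum>l<n. \<Sum>p\<le>k. ?t i l p * ?t l j (k - p))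
        = (\<lambda>k. (- 1) ^ k * real (1 choose k) * (X ^\<^sub>m k) $$ (i, j))"
    proof
      fix k
      have "(\<Sum>l<n. \<Sum>p\<le>k. ?t i l p * ?t l j (k - p))
          = (\<Sum>p\<le>k. sqrt_coeff p * sqrt_coeff (k - p) * (\<Sum>l<n. (X ^\<^sub>m p) $$ (i, l) * (X ^\<^sub>m (k - p)) $$ (l, j)))"
        by (subst sum.swap) (simp add: sum_distrib_left algebra_simps)
      also have "\<dots> = (\<Sum>p\<le>k. sqrt_coeff p * sqrt_coeff (k - p) * (X ^\<^sub>m k) $$ (i, j))"
      proof (rule sum.cong)
        fix p assume "p \<in> {..k}"
        then have "X ^\<^sub>m k = X ^\<^sub>m p * X ^\<^sub>m (k - p)"
          using pow_mat_add[OF X(1), of p "k - p"] by simp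
        then have "(\<Sum>l<n. (X ^\<^sub>m p) $$ (i, l) * (X ^\<^sub>m (k - p)) $$ (l, j)) = (X ^\<^sub>m k) $$ (i, j)"
          using X ij by (simp add: scalar_prod_def atLeast0LessThan)
        then show "sqrt_coeff p * sqrt_coeff (k - p) * (\<Sum>l<n. (X ^\<^sub>m p) $$ (i, l) * (X ^\<^sub>m (k - p)) $$ (l, j))
            = sqrt_coeff p * sqrt_coeff (k - p) * (X ^\<^sub>m k) $$ (i, j)" by simp
      qed simp
      finally show "(\<Sum>l<n. \<Sum>p\<le>k. ?t i l p * ?t l j (k - p))
          = (- 1) ^ k * real (1 choose k) * (X ^\<^sub>m k) $$ (i, j)"
        by (simp add: sqrt_coeff_convolution flip: sum_distrib_right)
    qed
    finally have "(\<lambda>k. (- 1) ^ k * real (1 choose k) * (X ^\<^sub>m k) $$ (i, j)) sums (S * S) $$ (i, j)" .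
    \<comment> \<open>The series of the square breaks off after the linear term.\<close>
    moreover have "(\<lambda>k. (- 1) ^ k * real (1 choose k) * (X ^\<^sub>m k) $$ (i, j)) sums
        (\<Sum>k\<in>{..1}. (- 1) ^ k * real (1 choose k) * (X ^\<^sub>m k) $$ (i, j))"
      by (rule sums_finite) (auto simp: binomial_eq_0)
    ultimately have "(S * S) $$ (i, j) = (\<Sum>k\<in>{..1}. (- 1) ^ k * real (1 choose k) * (X ^\<^sub>m k) $$ (i, j))"
      by (rule sums_unique2)
    then show "(S * S) $$ (i, j) = (1\<^sub>m n - X) $$ (i, j)"
      using X ij by simp
  qed (use S X in auto)
  ultimately show ?thesis using S by (intro bexI[of _ S]) (auto simp: pos_semidef_iff[OF S])
qed

text \<open>
  A crude bound, which suffices for scaling a matrix below the identity.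
\<close>

lemma quadratic_form_le_norm:
  fixes X :: "real mat"
  assumes "X \<in> carrier_mat n n" "x \<in> carrier_vec n"
  shows "x \<bullet> (X *\<^sub>v x) \<le> (\<Sum>i<n. \<Sum>j<n. \<bar>X $$ (i, j)\<bar>) * (x \<bullet> x)"
proof -
  have sq: "(x $ i)\<^sup>2 \<le> x \<bullet> x" if "i < n" for i
    unfolding scalar_prod_def
    using assms that member_le_sum[of i "{0..<n}" "\<lambda>i. x $ i * x $ i"]
    by (auto simp: power2_eq_square)
  have "x $ i * x $ j * X $$ (i, j) \<le> \<bar>X $$ (i, j)\<bar> * (x \<bullet> x)" if "i < n" "j < n" for i j
  proof -
    have "2 * \<bar>x $ i * x $ j\<bar> \<le> (x $ i)\<^sup>2 + (x $ j)\<^sup>2"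
      using sum_squares_bound[of "\<bar>x $ i\<bar>" "\<bar>x $ j\<bar>"] by (simp add: abs_mult)
    then have "\<bar>x $ i * x $ j\<bar> \<le> x \<bullet> x" using sq[OF that(1)] sq[OF that(2)] by simp
    then have "\<bar>x $ i * x $ j\<bar> * \<bar>X $$ (i, j)\<bar> \<le> (x \<bullet> x) * \<bar>X $$ (i, j)\<bar>"
      by (rule mult_right_mono) simp
    then show ?thesis by (simp add: abs_mult[symmetric] mult.commute)
  qed
  then show ?thesis
    unfolding quadratic_form_sum[OF assms] sum_distrib_right by (intro sum_mono) auto
qed

text \<open>
  Scaling makes \<open>X\<close> smaller than \<open>I\<close>, so the series applies to \<open>I - X / c\<close>.
\<close>

lemma sqrt_exists:
  assumes X: "X \<in> carrier_mat n n" "pos_semidef X"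
  shows "\<exists>S \<in> carrier_mat n n. pos_semidef S \<and> S * S = X"
proof -
  \<comment> \<open>The summand \<open>1\<close> keeps \<open>c\<close> positive for the zero matrix.\<close>
  define c where "c = 1 + (\<Sum>i<n. \<Sum>j<n. \<bar>X $$ (i, j)\<bar>)"
  have c: "0 < c" by (auto simp: c_def intro!: add_pos_nonneg sum_nonneg)
  define Y where "Y = (1 / c) \<cdot>\<^sub>m X"
  have Y: "Y \<in> carrier_mat n n" using X by (simp add: Y_def)
  have psdY: "pos_semidef Y" using pos_semidef_smult[OF X, of "1 / c"] c by (simp add: Y_def)
  have Z: "1\<^sub>m n - Y \<in> carrier_mat n n" using Y by (simp add: minus_carrier_mat)
  have "pos_semidef (1\<^sub>m n - Y)"
    unfolding pos_semidef_iff[OF Z]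
  proof (intro conjI ballI)
    show "(1\<^sub>m n - Y)\<^sup>T = 1\<^sub>m n - Y"
      using Y psdY by (simp add: transpose_minus[of _ n n] pos_semidef_def)
    fix x :: "real vec" assume x: "x \<in> carrier_vec n"
    have "x \<bullet> (X *\<^sub>v x) \<le> c * (x \<bullet> x)"
      using quadratic_form_le_norm[OF X(1) x] scalar_prod_self_nonneg[of x]
      by (simp add: c_def algebra_simps)
    moreover have "Y *\<^sub>v x = (1 / c) \<cdot>\<^sub>v (X *\<^sub>v x)"
      using X x unfolding Y_def by (simp add: smult_mat_mult_vec[of _ n n])
    then have "x \<bullet> (Y *\<^sub>v x) = (x \<bullet> (X *\<^sub>v x)) / c" using X x by simp
    ultimately have "x \<bullet> (Y *\<^sub>v x) \<le> x \<bullet> x" using c by (simp add: divide_le_eq mult.commute)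
    then show "0 \<le> x \<bullet> ((1\<^sub>m n - Y) *\<^sub>v x)"
      using quadratic_form_minus[of "1\<^sub>m n" n Y x] Y x by simp
  qed
  moreover have "1\<^sub>m n - (1\<^sub>m n - Y) = Y" using Y by (intro eq_matI) auto
  ultimately obtain S where S: "S \<in> carrier_mat n n" "pos_semidef S" "S * S = Y"
    using sqrt_exists_if_le_1[OF Z] psdY by auto
  have "(sqrt c \<cdot>\<^sub>m S) * (sqrt c \<cdot>\<^sub>m S) = c \<cdot>\<^sub>m (S * S)"
    using S c by (intro eq_matI) (auto simp flip: mult.assoc)
  also have "\<dots> = X" using S X c by (intro eq_matI) (auto simp: Y_def)
  finally show ?thesis
    using S pos_semidef_smult[OF S(1,2), of "sqrt c"] c by (intro bexI[of _ "sqrt c \<cdot>\<^sub>m S"]) auto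
qed

text \<open>
  With \<open>E = S - T\<close> one has \<open>S E + E T = S\<^sup>2 - T\<^sup>2 = 0\<close>.  Multiplying by \<open>E\<close> and taking traces gives
  \<open>tr (E S E) + tr (E T E) = 0\<close> for two positive semidefinite matrices.  Hence \<open>S\<close> and \<open>T\<close> both
  annihilate the range of \<open>E\<close>, so \<open>E\<^sup>2 = 0\<close>, and \<open>E = 0\<close> by symmetry.
\<close>

lemma sqrt_unique:
  assumes S: "S \<in> carrier_mat n n" "pos_semidef S" and T: "T \<in> carrier_mat n n" "pos_semidef T"
    and eq: "S * S = T * T"
  shows "S = T"
proof -
  define E where "E = S - T"
  have E: "E \<in> carrier_mat n n" using S T by (simp add: E_def minus_carrier_mat)
  have symS: "S\<^sup>T = S" and symT: "T\<^sup>T = T" using S T by (auto simp: pos_semidef_def)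
  have symE: "E\<^sup>T = E" using S T symS symT by (simp add: E_def transpose_minus[of _ n n])
  have "S * E + E * T = S * S - S * T + (S * T - T * T)"
    using S T by (simp add: E_def mult_minus_distrib_mat[of _ n n] minus_mult_distrib_mat[of _ n n])
  also have "\<dots> = 0\<^sub>m n n" using S T eq by (intro eq_matI) auto
  finally have zero: "S * E + E * T = 0\<^sub>m n n" .
  have EE: "E * S * E + E * E * T = 0\<^sub>m n n"
  proof -
    have "E * S * E + E * E * T = E * (S * E + E * T)"
      using S T E
      by (subst mult_add_distrib_mat[of _ n n _ n]) (auto simp: assoc_mult_mat[of _ n n _ n _ n])
    then show ?thesis using zero E by simp
  qed
  have cS: "E * S * E \<in> carrier_mat n n" and cT: "E * T * E \<in> carrier_mat n n"
    using E S T by auto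
  have psdS: "pos_semidef (E * S * E)" and psdT: "pos_semidef (E * T * E)"
    using pos_semidef_congruence[OF S(1) E S(2)] pos_semidef_congruence[OF T(1) E T(2)] symE by auto
  have "trace_mat (E * E * T) = trace_mat (E * T * E)"
    using trace_mat_comm[of E n n "E * T"] E T by (simp add: assoc_mult_mat[of _ n n _ n _ n])
  moreover have "trace_mat (E * S * E) + trace_mat (E * E * T) = trace_mat (0\<^sub>m n n)"
    unfolding EE[symmetric] using E S T by (intro trace_mat_add[symmetric]) auto
  ultimately have "trace_mat (E * S * E) + trace_mat (E * T * E) = 0"
    by (simp add: trace_mat_def)
  then have tr: "trace_mat (E * S * E) = 0" "trace_mat (E * T * E) = 0"
    using trace_mat_nonneg[OF cS psdS] trace_mat_nonneg[OF cT psdT] by linarith+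
  have "E = 0\<^sub>m n n"
  proof (rule mat_eq_if_mult_unit_vec_eq)
    fix j assume j: "j < n"
    define v where "v = E *\<^sub>v unit_vec n j"
    have v: "v \<in> carrier_vec n" using E by (simp add: v_def)
    have "v \<bullet> (S *\<^sub>v v) = 0" "v \<bullet> (T *\<^sub>v v) = 0"
      using trace_mat_eq_0D[OF cS psdS tr(1) j] trace_mat_eq_0D[OF cT psdT tr(2) j]
        quadratic_form_congruence[OF S(1) E, of "unit_vec n j"]
        quadratic_form_congruence[OF T(1) E, of "unit_vec n j"] symE
      by (auto simp: v_def)
    then have "S *\<^sub>v v = 0\<^sub>v n" "T *\<^sub>v v = 0\<^sub>v n"
      using pos_semidef_quadratic_form_eq_0D[OF S v] pos_semidef_quadratic_form_eq_0D[OF T v] by auto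
    then have "E *\<^sub>v v = 0\<^sub>v n"
      using S T v by (simp add: E_def minus_mult_distrib_mat_vec[of _ n n])
    then have "v \<bullet> v = 0"
      using symmetric_scalar_prod[OF E symE unit_vec_carrier v, of j] by (simp add: v_def[symmetric])
    then show "E *\<^sub>v unit_vec n j = 0\<^sub>m n n *\<^sub>v unit_vec n j"
      using scalar_prod_self_eq_0D[OF _ v] j by (simp add: v_def mult_mat_unit_vec[of _ n n])
  qed (use E in auto)
  moreover have "S = E + T" using S T by (intro eq_matI) (auto simp: E_def)
  ultimately show ?thesis using T by simp
qed

lemma mat_sqrt:
  assumes X: "X \<in> carrier_mat n n" "pos_semidef X"
  shows "mat_sqrt X \<in> carrier_mat n n" "pos_semidef (mat_sqrt X)" "mat_sqrt X * mat_sqrt X = X"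
proof -
  obtain S where S: "S \<in> carrier_mat n n" "pos_semidef S" "S * S = X"
    using sqrt_exists[OF X] by auto
  have "mat_sqrt X = S"
    unfolding mat_sqrt_def
  proof (rule the_equality)
    fix T assume T: "pos_semidef T \<and> T * T = X"
    then have "dim_row T = dim_col T" unfolding pos_semidef_def by (metis index_transpose_mat(2))
    moreover have "dim_row T = n" using T X by auto
    ultimately have "T \<in> carrier_mat n n" by auto
    then show "T = S" using sqrt_unique S T by metis
  qed (use S in simp)
  then show "mat_sqrt X \<in> carrier_mat n n" "pos_semidef (mat_sqrt X)" "mat_sqrt X * mat_sqrt X = X"
    using S by auto
qed

lemma symmetric_smult_mat_sqrt:
  assumes "X \<in> carrier_mat n n" "pos_semidef X"
  shows "(l \<cdot>\<^sub>m mat_sqrt X)\<^sup>T = l \<cdot>\<^sub>m mat_sqrt X"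
proof -
  have "(l \<cdot>\<^sub>m mat_sqrt X)\<^sup>T = l \<cdot>\<^sub>m (mat_sqrt X)\<^sup>T" by (rule eq_matI) auto
  then show ?thesis using mat_sqrt(2)[OF assms] by (simp add: pos_semidef_def)
qed

lemma trace_mat_sqrt_congruence:
  assumes \<Sigma>: "\<Sigma> \<in> carrier_mat r r" "pos_semidef \<Sigma>" and H: "H \<in> carrier_mat r r"
  shows "trace_mat ((l \<cdot>\<^sub>m mat_sqrt \<Sigma>)\<^sup>T * H * (l \<cdot>\<^sub>m mat_sqrt \<Sigma>)) = l * (l * trace_mat (\<Sigma> * H))"
proof -
  note sqrt = mat_sqrt[OF \<Sigma>]
  let ?F = "l \<cdot>\<^sub>m mat_sqrt \<Sigma>"
  have F: "?F \<in> carrier_mat r r" using sqrt by simp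
  have "trace_mat (?F\<^sup>T * H * ?F) = trace_mat (?F * (?F * H))"
    unfolding symmetric_smult_mat_sqrt[OF \<Sigma>] using F H by (intro trace_mat_comm) auto
  also have "?F * (?F * H) = l \<cdot>\<^sub>m (l \<cdot>\<^sub>m (mat_sqrt \<Sigma> * (mat_sqrt \<Sigma> * H)))"
    using H sqrt(1)
    by (simp add: mult_smult_distrib[of _ r r _ r] mult_smult_assoc_mat[of _ r r _ r])
  also have "mat_sqrt \<Sigma> * (mat_sqrt \<Sigma> * H) = \<Sigma> * H"
    using assoc_mult_mat[OF sqrt(1,1) H] sqrt(3) by simp
  also have "trace_mat (l \<cdot>\<^sub>m (l \<cdot>\<^sub>m (\<Sigma> * H))) = l * (l * trace_mat (\<Sigma> * H))"
    using H \<Sigma> by (simp add: trace_mat_def sum_distrib_left del: index_mult_mat(1))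
  finally show ?thesis .
qed

lemma mat_sqrt_mult_vec_eq_0D:
  assumes \<Sigma>: "\<Sigma> \<in> carrier_mat r r" "pos_def \<Sigma>" and x: "x \<in> carrier_vec r"
    and l: "l \<noteq> 0" and eq: "(l \<cdot>\<^sub>m mat_sqrt \<Sigma>) *\<^sub>v x = 0\<^sub>v r"
  shows "x = 0\<^sub>v r"
proof (rule ccontr)
  assume nz: "x \<noteq> 0\<^sub>v r"
  note sqrt = mat_sqrt[OF \<Sigma>(1) pos_def_imp_pos_semidef[OF \<Sigma>]]
  let ?y = "mat_sqrt \<Sigma> *\<^sub>v x"
  have y: "?y \<in> carrier_vec r" using sqrt x by simp
  have ly: "l \<cdot>\<^sub>v ?y = 0\<^sub>v r" using eq smult_mat_mult_vec[OF sqrt(1) x] by simp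
  have "?y = (1 / l) \<cdot>\<^sub>v (l \<cdot>\<^sub>v ?y)" using l by (simp add: smult_smult_assoc)
  also have "\<dots> = 0\<^sub>v r" unfolding ly by (rule eq_vecI) auto
  finally have "?y = 0\<^sub>v r" .
  then have "\<Sigma> *\<^sub>v x = mat_sqrt \<Sigma> *\<^sub>v 0\<^sub>v r"
    using assoc_mult_mat_vec[OF sqrt(1,1) x] sqrt(3) by simp
  also have "\<dots> = 0\<^sub>v r" using sqrt(1) by (auto intro!: eq_vecI)
  finally show False using \<Sigma>(2) x nz by (auto simp: pos_def_iff[OF \<Sigma>(1)])
qed

section \<open>Stacked responses and causal gains\<close>

lemma stacked_response_carrier:
  assumes "G \<in> carrier_mat n m"
  shows "stacked_response N A G \<in> carrier_mat ((N + 1) * n) (N * m)"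
  using assms by (auto simp: stacked_response_def)

text \<open>
  Block \<open>(k, i)\<close> of the response vanishes unless \<open>i < k\<close>, and block \<open>(i, j)\<close> of the gain unless
  \<open>j \<le> i\<close>.  The product is thus strictly lower triangular, and the difference lower triangular with
  unit diagonal.
\<close>

lemma det_one_minus_response_gain:
  assumes G: "G \<in> carrier_mat n m" and K: "causal_gain N n m K"
  shows "det (1\<^sub>m ((N + 1) * n) - stacked_response N A G * K) = 1"
proof -
  define p where "p = (N + 1) * n"
  define U where "U = stacked_response N A G"
  have U: "U \<in> carrier_mat p (N * m)"
    using stacked_response_carrier[OF G] by (simp add: U_def p_def)
  have Kc: "K \<in> carrier_mat (N * m) p" using K by (simp add: causal_gain_def p_def)
  have zero: "(U * K) $$ (i, j) = 0" if ij: "i < p" "j < p" "i \<le> j" for i j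
  proof -
    have "U $$ (i, s) * K $$ (s, j) = 0" if s: "s < N * m" for s
    proof (cases "s div m < i div n")
      case True
      then have "s div m < j div n" using div_le_mono[OF ij(3), of n] by simp
      then show ?thesis using K s ij(2) by (simp add: causal_gain_def p_def)
    next
      case False
      then show ?thesis using s ij G by (simp add: U_def stacked_response_def p_def)
    qed
    then show ?thesis using U Kc ij by (auto simp: scalar_prod_def intro!: sum.neutral)
  qed
  have M: "1\<^sub>m p - U * K \<in> carrier_mat p p" using U Kc by (simp add: minus_carrier_mat)
  have "det (1\<^sub>m p - U * K) = prod_list (diag_mat (1\<^sub>m p - U * K))"
    using zero U Kc by (intro det_lower_triangular[OF _ M]) auto
  also have "diag_mat (1\<^sub>m p - U * K) = map (\<lambda>_. 1) [0..<p]"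
    unfolding diag_mat_def using zero U Kc by (intro map_cong) auto
  also have "prod_list (map (\<lambda>_. 1 :: real) [0..<p]) = 1"
    by (simp add: map_replicate_const)
  finally show ?thesis by (simp add: U_def p_def)
qed

section \<open>The closed-loop cost matrix\<close>

lemma congruence_mult:
  fixes X F E :: "real mat"
  assumes X: "X \<in> carrier_mat p p" and F: "F \<in> carrier_mat p q" and E: "E \<in> carrier_mat q r"
  shows "E\<^sup>T * (F\<^sup>T * X * F) * E = (F * E)\<^sup>T * X * (F * E)"
proof -
  have Ft: "F\<^sup>T \<in> carrier_mat q p" and Et: "E\<^sup>T \<in> carrier_mat r q"
    and FX: "F\<^sup>T * X \<in> carrier_mat q p" and FE: "F * E \<in> carrier_mat p r"
    using X F E by auto
  have FXF: "F\<^sup>T * X * F \<in> carrier_mat q q" by (rule mult_carrier_mat[OF FX F])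
  show ?thesis
    unfolding transpose_mult[OF F E] assoc_mult_mat[OF Et Ft X] assoc_mult_mat[OF Et FX FE]
      assoc_mult_mat[OF Et FXF E] assoc_mult_mat[OF FX F E] ..
qed

lemma congruence_add:
  fixes X Y F :: "real mat"
  assumes X: "X \<in> carrier_mat p p" and Y: "Y \<in> carrier_mat p p" and F: "F \<in> carrier_mat p q"
  shows "F\<^sup>T * (X + Y) * F = F\<^sup>T * X * F + F\<^sup>T * Y * F"
proof -
  have Ft: "F\<^sup>T \<in> carrier_mat q p" using F by simp
  show ?thesis
    unfolding mult_add_distrib_mat[OF Ft X Y]
    by (rule add_mult_distrib_mat[OF mult_carrier_mat[OF Ft X] mult_carrier_mat[OF Ft Y] F])
qed

lemma congruence_one_add:
  fixes Q G :: "real mat"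
  assumes Q: "Q \<in> carrier_mat p p" "Q\<^sup>T = Q" and G: "G \<in> carrier_mat p p"
  shows "(1\<^sub>m p + G)\<^sup>T * Q * (1\<^sub>m p + G) = Q + Q * G + (Q * G)\<^sup>T + G\<^sup>T * Q * G"
proof -
  have Gt: "G\<^sup>T \<in> carrier_mat p p" and GQ: "G\<^sup>T * Q \<in> carrier_mat p p" and QG: "Q * G \<in> carrier_mat p p"
    using Q G by auto
  have GQG: "G\<^sup>T * Q * G \<in> carrier_mat p p" by (rule mult_carrier_mat[OF GQ G])
  have "(1\<^sub>m p + G)\<^sup>T * Q = Q + G\<^sup>T * Q"
    using Q G by (simp add: transpose_add[of _ p p] add_mult_distrib_mat[OF one_carrier_mat Gt Q(1)])
  then have "(1\<^sub>m p + G)\<^sup>T * Q * (1\<^sub>m p + G) = (Q + G\<^sup>T * Q) + (Q + G\<^sup>T * Q) * G"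
    using mult_add_distrib_mat[OF add_carrier_mat[OF GQ, of Q] one_carrier_mat G] Q GQ by simp
  also have "(Q + G\<^sup>T * Q) * G = Q * G + G\<^sup>T * Q * G"
    by (rule add_mult_distrib_mat[OF Q(1) GQ G])
  also have "(Q * G)\<^sup>T = G\<^sup>T * Q" using Q G by (simp add: transpose_mult[of _ p p])
  then have "(Q + G\<^sup>T * Q) + (Q * G + G\<^sup>T * Q * G) = Q + Q * G + (Q * G)\<^sup>T + G\<^sup>T * Q * G"
    using Q(1) GQ QG GQG by (intro eq_matI) (auto simp del: index_mult_mat(1))
  finally show ?thesis .
qed

text \<open>
  In the expansion of \<open>(I + \<B> L)\<^sup>T \<Q> (I + \<B> L)\<close> the terms up to first order in \<open>L\<close> form \<open>M_tilde\<close>;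
  the second-order term joins the input cost to give \<open>L\<^sup>T R_tilde L\<close>.
\<close>

lemma Xi_eq:
  assumes B: "B \<in> carrier_mat p q" and D: "D \<in> carrier_mat p r"
    and Q: "Q \<in> carrier_mat p p" "Q\<^sup>T = Q" and R: "R \<in> carrier_mat q q" and L: "L \<in> carrier_mat q p"
  shows "Xi B D Q R L = D\<^sup>T * M_tilde B Q L * D + (L * D)\<^sup>T * R_tilde B Q R * (L * D)"
proof -
  have BL: "B * L \<in> carrier_mat p p" using B L by simp
  have M_mat: "M_mat B Q L = Q * (B * L)"
    unfolding M_mat_def by (rule assoc_mult_mat[OF Q(1) B L])
  have M: "M_tilde B Q L \<in> carrier_mat p p" using M_mat Q BL by (simp add: M_tilde_def)
  have BQB: "B\<^sup>T * Q * B \<in> carrier_mat q q" using B Q by simp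
  have Rt: "R_tilde B Q R \<in> carrier_mat q q" using BQB R by (simp add: R_tilde_def)
  have c: "L\<^sup>T * (B\<^sup>T * Q * B) * L \<in> carrier_mat p p" "L\<^sup>T * R * L \<in> carrier_mat p p"
    using BQB R L by auto
  have "(1\<^sub>m p + B * L)\<^sup>T * Q * (1\<^sub>m p + B * L) + L\<^sup>T * R * L
      = M_tilde B Q L + L\<^sup>T * (B\<^sup>T * Q * B) * L + L\<^sup>T * R * L"
    unfolding congruence_one_add[OF Q BL] congruence_mult[OF Q(1) B L] M_tilde_def M_mat ..
  also have "\<dots> = M_tilde B Q L + L\<^sup>T * R_tilde B Q R * L"
    unfolding R_tilde_def congruence_add[OF BQB R L] by (rule assoc_add_mat[OF M c])
  finally have "Xi B D Q R L = D\<^sup>T * (M_tilde B Q L + L\<^sup>T * R_tilde B Q R * L) * D"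
    using B by (simp add: Xi_def)
  also have "\<dots> = D\<^sup>T * M_tilde B Q L * D + (L * D)\<^sup>T * R_tilde B Q R * (L * D)"
    unfolding congruence_add[OF M mult_carrier_mat[OF mult_carrier_mat[OF transpose_carrier_mat[THEN iffD2, OF L] Rt] L] D]
      congruence_mult[OF Rt L D] ..
  finally show ?thesis .
qed

lemma pos_semidef_Xi:
  assumes B: "B \<in> carrier_mat p q" and D: "D \<in> carrier_mat p r"
    and Q: "Q \<in> carrier_mat p p" "pos_semidef Q" and R: "R \<in> carrier_mat q q" "pos_semidef R"
    and L: "L \<in> carrier_mat q p"
  shows "pos_semidef (Xi B D Q R L)"
proof -
  have c: "1\<^sub>m p + B * L \<in> carrier_mat p p" using B L by simp
  have "pos_semidef ((1\<^sub>m p + B * L)\<^sup>T * Q * (1\<^sub>m p + B * L) + L\<^sup>T * R * L)"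
    using pos_semidef_congruence[OF Q(1) c Q(2)] pos_semidef_congruence[OF R(1) L R(2)] c Q R L
    by (intro pos_semidef_add[of _ p]) auto
  then have "pos_semidef (D\<^sup>T * ((1\<^sub>m p + B * L)\<^sup>T * Q * (1\<^sub>m p + B * L) + L\<^sup>T * R * L) * D)"
    using c Q R L by (intro pos_semidef_congruence[OF _ D]) auto
  then show ?thesis using B by (simp add: Xi_def)
qed

lemma pos_def_R_tilde:
  assumes B: "B \<in> carrier_mat p q" and Q: "Q \<in> carrier_mat p p" "pos_semidef Q"
    and R: "R \<in> carrier_mat q q" "pos_def R"
  shows "pos_def (R_tilde B Q R)"
proof -
  have c: "B\<^sup>T * Q * B \<in> carrier_mat q q" using B Q by simp
  have psd: "pos_semidef (B\<^sup>T * Q * B)" by (rule pos_semidef_congruence[OF Q(1) B Q(2)])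
  have cR: "B\<^sup>T * Q * B + R \<in> carrier_mat q q" using c R by simp
  show ?thesis
    unfolding R_tilde_def pos_def_iff[OF cR]
  proof (intro conjI ballI impI)
    show "(B\<^sup>T * Q * B + R)\<^sup>T = B\<^sup>T * Q * B + R"
      using c psd R by (simp add: transpose_add[of _ q q] pos_semidef_def pos_def_def)
    fix x :: "real vec" assume x: "x \<in> carrier_vec q" "x \<noteq> 0\<^sub>v q"
    have "x \<bullet> ((B\<^sup>T * Q * B + R) *\<^sub>v x) = x \<bullet> ((B\<^sup>T * Q * B) *\<^sub>v x) + x \<bullet> (R *\<^sub>v x)"
      using x c R
      by (simp add: add_mult_distrib_mat_vec[of _ q q] scalar_prod_add_distrib[of _ q] del: assoc_mult_mat_vec)
    moreover have "0 \<le> x \<bullet> ((B\<^sup>T * Q * B) *\<^sub>v x)" using psd x unfolding pos_semidef_iff[OF c] by blast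
    moreover have "0 < x \<bullet> (R *\<^sub>v x)" using R x unfolding pos_def_iff[OF R(1)] by blast
    ultimately show "0 < x \<bullet> ((B\<^sup>T * Q * B + R) *\<^sub>v x)" by linarith
  qed
qed

text \<open>
  The lower right block is itself an inverse, so the Schur complement brings back \<open>R_tilde\<close>, and
  \<open>Xi_eq\<close> collects its terms into \<open>\<Xi>\<close>.
\<close>

lemma cost_lmi_iff:
  assumes B: "B \<in> carrier_mat p q" and D: "D \<in> carrier_mat p r"
    and Q: "Q \<in> carrier_mat p p" "pos_semidef Q" and R: "R \<in> carrier_mat q q" "pos_def R"
    and L: "L \<in> carrier_mat q p" and \<Psi>: "\<Psi> \<in> carrier_mat r r"
  shows "pos_semidef (four_block_mat (l \<cdot>\<^sub>m 1\<^sub>m r - D\<^sup>T * M_tilde B Q L * D - \<Psi>) (D\<^sup>T * L\<^sup>T)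
      (L * D) (mat_inv (R_tilde B Q R)))
    \<longleftrightarrow> pos_semidef (l \<cdot>\<^sub>m 1\<^sub>m r - Xi B D Q R L - \<Psi>)"
proof -
  have symQ: "Q\<^sup>T = Q" using Q by (simp add: pos_semidef_def)
  have Rt: "R_tilde B Q R \<in> carrier_mat q q" using B Q R by (simp add: R_tilde_def)
  have pdR: "pos_def (R_tilde B Q R)" by (rule pos_def_R_tilde[OF B Q R])
  note inv = mat_inv_if_pos_def[OF Rt Rt pdR]
  have inv_inv: "mat_inv (mat_inv (R_tilde B Q R)) = R_tilde B Q R"
    by (rule mat_inv_eqI[OF inv(1) Rt inv(3)])
  have LD: "L * D \<in> carrier_mat q r" using L D by simp
  have "M_mat B Q L \<in> carrier_mat p p" using B Q L by (simp add: M_mat_def)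
  then have "M_tilde B Q L \<in> carrier_mat p p" using Q by (simp add: M_tilde_def)
  then have Z: "D\<^sup>T * M_tilde B Q L * D \<in> carrier_mat r r" using D by simp
  have W: "(L * D)\<^sup>T * R_tilde B Q R * (L * D) \<in> carrier_mat r r" using LD Rt by simp
  have A: "l \<cdot>\<^sub>m 1\<^sub>m r - D\<^sup>T * M_tilde B Q L * D - \<Psi> \<in> carrier_mat r r"
    using \<Psi> by (rule minus_carrier_mat)
  have regroup: "E - Y - \<Psi> - V = E - (Y + V) - \<Psi>"
    if "E \<in> carrier_mat r r" "Y \<in> carrier_mat r r" "V \<in> carrier_mat r r" for E Y V :: "real mat"
    using that \<Psi> by (intro eq_matI) auto
  have "l \<cdot>\<^sub>m 1\<^sub>m r - D\<^sup>T * M_tilde B Q L * D - \<Psi> - (L * D)\<^sup>T * R_tilde B Q R * (L * D)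
      = l \<cdot>\<^sub>m 1\<^sub>m r - Xi B D Q R L - \<Psi>"
    unfolding Xi_eq[OF B D Q(1) symQ R(1) L]
    by (rule regroup[OF _ Z W]) simp
  then show ?thesis
    using pos_semidef_schur_complement[OF A LD inv(1) pos_def_mat_inv[OF Rt pdR]]
    by (simp add: inv_inv transpose_mult[OF L D])
qed

section \<open>Comparison of the two programs\<close>

text \<open>
  If \<open>\<Xi> = 0\<close>, then \<open>\<lambda> tr (\<Sigma> (\<lambda> I)\<inverse>)\<close> cancels \<open>tr \<Sigma>\<close> and the objective is \<open>\<lambda> \<epsilon>\<^sup>2\<close>, which
  is arbitrarily small but not zero on \<open>\<lambda> > 0\<close>.
\<close>

lemma dual_value_zero_le:
  assumes \<Sigma>: "\<Sigma> \<in> carrier_mat r r" and \<epsilon>: "\<epsilon> \<noteq> 0"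
  shows "dual_value \<epsilon> \<Sigma> (0\<^sub>m r r) \<le> 0"
proof -
  have "dual_value \<epsilon> \<Sigma> (0\<^sub>m r r) \<le> 0 + ereal \<delta>" if \<delta>: "0 < \<delta>" for \<delta>
  proof -
    \<comment> \<open>The multiplier at which the objective \<open>t \<epsilon>\<^sup>2\<close> equals \<open>\<delta>\<close>.\<close>
    define t where "t = \<delta> / \<epsilon>\<^sup>2"
    have t: "0 < t" using \<delta> \<epsilon> by (simp add: t_def)
    have P: "t \<cdot>\<^sub>m 1\<^sub>m r - 0\<^sub>m r r = t \<cdot>\<^sub>m (1\<^sub>m r :: real mat)" by (rule eq_matI) auto
    have "\<Sigma> * mat_inv (t \<cdot>\<^sub>m 1\<^sub>m r) = (1 / t) \<cdot>\<^sub>m \<Sigma>"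
      using t \<Sigma> by (simp add: mat_inv_smult_one mult_smult_distrib[of _ r r _ r])
    then have "trace_mat (\<Sigma> * mat_inv (t \<cdot>\<^sub>m 1\<^sub>m r)) = trace_mat \<Sigma> / t"
      using \<Sigma> by (simp add: trace_mat_def sum_divide_distrib)
    then have "t * (\<epsilon>\<^sup>2 - trace_mat \<Sigma> + t * trace_mat (\<Sigma> * mat_inv (t \<cdot>\<^sub>m 1\<^sub>m r))) = \<delta>"
      using t \<epsilon> by (simp add: t_def)
    then show ?thesis
      unfolding dual_value_def
      using pos_def_smult_one[OF t, of r] \<Sigma> by (intro INF_lower2[of t]) (auto simp: P)
  qed
  then show ?thesis by (rule ereal_le_epsilon2)
qed

text \<open>
  For \<open>l > 0\<close> the constraints make \<open>l\<close> admissible in the dual program, with an objective value that is no larger.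
  The multiplier \<open>l = 0\<close> is admissible for the semidefinite program but in general not for the dual one, and
  has to be compared with the limit of small multipliers instead.
\<close>

lemma dual_value_le_sdp_objective:
  assumes X: "X \<in> carrier_mat r r" "pos_semidef X"
    and \<Sigma>: "\<Sigma> \<in> carrier_mat r r" "pos_def \<Sigma>" and \<epsilon>: "\<epsilon> \<noteq> 0" and l: "0 \<le> l"
    and \<Gamma>: "\<Gamma> \<in> carrier_mat r r" "pos_semidef \<Gamma>" and \<Psi>: "\<Psi> \<in> carrier_mat r r" "pos_semidef \<Psi>"
    and lmi1: "pos_semidef (four_block_mat \<Gamma> (l \<cdot>\<^sub>m mat_sqrt \<Sigma>) (l \<cdot>\<^sub>m mat_sqrt \<Sigma>) \<Psi>)"
    and lmi2: "pos_semidef (l \<cdot>\<^sub>m 1\<^sub>m r - X - \<Psi>)"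
  shows "dual_value \<epsilon> \<Sigma> X \<le> ereal (l * (\<epsilon>\<^sup>2 - trace_mat \<Sigma>) + trace_mat \<Gamma>)"
proof (cases "l = 0")
  case True
  have "X = 0\<^sub>m r r"
    using neg_pos_semidef_imp_zero[OF X \<Psi>] lmi2 True by simp
  then have "dual_value \<epsilon> \<Sigma> X \<le> 0" using dual_value_zero_le[OF \<Sigma>(1) \<epsilon>] by simp
  also have "0 \<le> ereal (l * (\<epsilon>\<^sup>2 - trace_mat \<Sigma>) + trace_mat \<Gamma>)"
    using True trace_mat_nonneg[OF \<Gamma>] by simp
  finally show ?thesis .
next
  case False
  define F where "F = l \<cdot>\<^sub>m mat_sqrt \<Sigma>"
  define P where "P = l \<cdot>\<^sub>m 1\<^sub>m r - X"
  note psd\<Sigma> = pos_def_imp_pos_semidef[OF \<Sigma>]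
  have F: "F \<in> carrier_mat r r" using mat_sqrt(1)[OF \<Sigma>(1) psd\<Sigma>] by (simp add: F_def)
  have symF: "F\<^sup>T = F" unfolding F_def by (rule symmetric_smult_mat_sqrt[OF \<Sigma>(1) psd\<Sigma>])
  have P: "P \<in> carrier_mat r r" unfolding P_def using X(1) by (rule minus_carrier_mat)
  have lmi: "pos_semidef (four_block_mat \<Gamma> F\<^sup>T F P)"
    using pos_semidef_four_block_mono[OF \<Gamma>(1) F \<Psi>(1) P] lmi1 lmi2
    by (simp add: symF F_def[symmetric] P_def[symmetric])
  have pd: "pos_def P"
  proof (rule pos_def_if_pos_semidef_four_block[OF \<Gamma>(1) F P lmi])
    fix y assume "y \<in> carrier_vec r" "F\<^sup>T *\<^sub>v y = 0\<^sub>v r"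
    then show "y = 0\<^sub>v r"
      unfolding symF unfolding F_def using mat_sqrt_mult_vec_eq_0D[OF \<Sigma>] False by blast
  qed
  have "l * (l * trace_mat (\<Sigma> * mat_inv P)) = trace_mat (F\<^sup>T * mat_inv P * F)"
    unfolding F_def using trace_mat_sqrt_congruence[OF \<Sigma>(1) psd\<Sigma> mat_inv_if_pos_def(1)[OF P P pd]] by simp
  also have "\<dots> \<le> trace_mat \<Gamma>" by (rule trace_mat_schur_complement_le[OF \<Gamma>(1) F P pd lmi])
  finally show ?thesis
    unfolding dual_value_def using pd \<Sigma>(1)
    by (intro INF_lower2[of l]) (auto simp: P_def[symmetric] algebra_simps)
qed

text \<open>
  The witness \<open>\<Psi> = P\<close>, \<open>\<Gamma> = F\<^sup>T P\<inverse> F\<close> makes both Schur complements zero.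
\<close>

lemma sdp_value_le_dual_objective:
  assumes B: "B \<in> carrier_mat p q" and D: "D \<in> carrier_mat p r"
    and Q: "Q \<in> carrier_mat p p" "pos_semidef Q" and R: "R \<in> carrier_mat q q" "pos_def R"
    and L: "L \<in> carrier_mat q p"
    and \<Sigma>: "\<Sigma> \<in> carrier_mat r r" "pos_semidef \<Sigma>" and r: "0 < r"
    and pd: "pos_def (l \<cdot>\<^sub>m 1\<^sub>m r - Xi B D Q R L)"
  shows "sdp_value \<epsilon> \<Sigma> B D Q R L \<le>
    ereal (l * (\<epsilon>\<^sup>2 - trace_mat \<Sigma> + l * trace_mat (\<Sigma> * mat_inv (l \<cdot>\<^sub>m 1\<^sub>m r - Xi B D Q R L))))"
proof -
  define X where "X = Xi B D Q R L"
  define F where "F = l \<cdot>\<^sub>m mat_sqrt \<Sigma>"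
  define P where "P = l \<cdot>\<^sub>m 1\<^sub>m r - X"
  define \<Gamma> where "\<Gamma> = F\<^sup>T * mat_inv P * F"
  have pdP: "pos_def P" using pd by (simp add: P_def X_def)
  have X: "X \<in> carrier_mat r r" using D unfolding X_def Xi_def by (intro carrier_matI) auto
  have psdX: "pos_semidef X"
    unfolding X_def by (rule pos_semidef_Xi[OF B D Q R(1) pos_def_imp_pos_semidef[OF R] L])
  have F: "F \<in> carrier_mat r r" using mat_sqrt(1)[OF \<Sigma>] by (simp add: F_def)
  have symF: "F\<^sup>T = F" unfolding F_def by (rule symmetric_smult_mat_sqrt[OF \<Sigma>])
  have P: "P \<in> carrier_mat r r" unfolding P_def using X by (rule minus_carrier_mat)
  note inv = mat_inv_if_pos_def[OF P P pdP]
  have \<Gamma>: "\<Gamma> \<in> carrier_mat r r" using F inv by (simp add: \<Gamma>_def)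
  have psd\<Gamma>: "pos_semidef \<Gamma>"
    unfolding \<Gamma>_def
    by (rule pos_semidef_congruence[OF inv(1) F pos_def_imp_pos_semidef[OF inv(1) pos_def_mat_inv[OF P pdP]]])
  \<comment> \<open>Compare the first diagonal entries in \<open>X \<prec> l I\<close>; there is one because \<open>r > 0\<close>.\<close>
  have l: "0 < l"
  proof -
    have "unit_vec r 0 \<noteq> (0\<^sub>v r :: real vec)" using r by simp
    then have "0 < P $$ (0, 0)"
      using pdP r quadratic_form_unit_vec[OF P r] unfolding pos_def_iff[OF P]
      by (metis unit_vec_carrier)
    then show ?thesis using diagonal_nonneg[OF X psdX r] X r by (simp add: P_def)
  qed
  have zero: "Z - Z = 0\<^sub>m r r" if "Z \<in> carrier_mat r r" for Z :: "real mat"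
    using that by (intro eq_matI) auto
  have "pos_semidef (four_block_mat \<Gamma> F\<^sup>T F P)"
    unfolding pos_semidef_schur_complement[OF \<Gamma> F P pdP] \<Gamma>_def[symmetric] zero[OF \<Gamma>]
    by (rule pos_semidef_zero)
  moreover have "pos_semidef (l \<cdot>\<^sub>m 1\<^sub>m r - Xi B D Q R L - P)"
    unfolding X_def[symmetric] P_def[symmetric] zero[OF P] by (rule pos_semidef_zero)
  ultimately have "(l, \<Gamma>, P) \<in> sdp_feasible \<Sigma> B D Q R L"
    using l \<Gamma> psd\<Gamma> P pos_def_imp_pos_semidef[OF P pdP] \<Sigma>(1)
    by (simp add: sdp_feasible_def cost_lmi_iff[OF B D Q R L P] symF F_def[symmetric])
  moreover have "trace_mat \<Gamma> = l * (l * trace_mat (\<Sigma> * mat_inv P))"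
    unfolding \<Gamma>_def F_def by (rule trace_mat_sqrt_congruence[OF \<Sigma> inv(1)])
  ultimately show ?thesis
    unfolding sdp_value_def
    by (intro INF_lower2[of "(l, \<Gamma>, P)"]) (auto simp: X_def[symmetric] P_def[symmetric] algebra_simps)
qed

text \<open>
  The comparison for abstract matrices; the block structure of the stacked data serves to guarantee the
  dimensions and the definiteness assumed here.
\<close>

lemma dual_value_eq_sdp_value:
  assumes B: "B \<in> carrier_mat p q" and D: "D \<in> carrier_mat p r"
    and Q: "Q \<in> carrier_mat p p" "pos_semidef Q" and R: "R \<in> carrier_mat q q" "pos_def R"
    and L: "L \<in> carrier_mat q p"
    and \<Sigma>: "\<Sigma> \<in> carrier_mat r r" "pos_def \<Sigma>" and r: "0 < r" and \<epsilon>: "\<epsilon> \<noteq> 0"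
  shows "dual_value \<epsilon> \<Sigma> (Xi B D Q R L) = sdp_value \<epsilon> \<Sigma> B D Q R L"
proof (rule antisym)
  have X: "Xi B D Q R L \<in> carrier_mat r r" using D unfolding Xi_def by (intro carrier_matI) auto
  have psdX: "pos_semidef (Xi B D Q R L)"
    by (rule pos_semidef_Xi[OF B D Q R(1) pos_def_imp_pos_semidef[OF R] L])
  show "dual_value \<epsilon> \<Sigma> (Xi B D Q R L) \<le> sdp_value \<epsilon> \<Sigma> B D Q R L"
    unfolding sdp_value_def
  proof (rule INF_greatest, clarify)
    fix l \<Gamma> \<Psi> assume "(l, \<Gamma>, \<Psi>) \<in> sdp_feasible \<Sigma> B D Q R L"
    then have "0 \<le> l" and \<Gamma>: "\<Gamma> \<in> carrier_mat r r" "pos_semidef \<Gamma>"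
      and \<Psi>: "\<Psi> \<in> carrier_mat r r" "pos_semidef \<Psi>"
      and "pos_semidef (four_block_mat \<Gamma> (l \<cdot>\<^sub>m mat_sqrt \<Sigma>) (l \<cdot>\<^sub>m mat_sqrt \<Sigma>) \<Psi>)"
      and "pos_semidef (four_block_mat (l \<cdot>\<^sub>m 1\<^sub>m r - D\<^sup>T * M_tilde B Q L * D - \<Psi>) (D\<^sup>T * L\<^sup>T)
        (L * D) (mat_inv (R_tilde B Q R)))"
      unfolding sdp_feasible_def carrier_matD(1)[OF \<Sigma>(1)] by blast+
    then show "dual_value \<epsilon> \<Sigma> (Xi B D Q R L) \<le> ereal (l * (\<epsilon>\<^sup>2 - trace_mat \<Sigma>) + trace_mat \<Gamma>)"
      unfolding cost_lmi_iff[OF B D Q R L \<Psi>(1)]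
      by (intro dual_value_le_sdp_objective[OF X psdX \<Sigma> \<epsilon> _ \<Gamma> \<Psi>])
  qed
next
  show "sdp_value \<epsilon> \<Sigma> B D Q R L \<le> dual_value \<epsilon> \<Sigma> (Xi B D Q R L)"
    unfolding dual_value_def carrier_matD(1)[OF \<Sigma>(1)]
    using sdp_value_le_dual_objective[OF B D Q R L \<Sigma>(1) pos_def_imp_pos_semidef[OF \<Sigma>] r]
    by (intro INF_greatest) blast
qed

theorem corollary2:
  fixes N n m d :: nat
    and A B D \<B> \<D> \<Q> \<R> K L \<Sigma>\<^sub>w :: "real mat"
    and Q R :: "nat \<Rightarrow> real mat"
    and \<epsilon> :: real
  assumes "0 < N" "0 < n" "0 < m" "0 < d"
    and "A \<in> carrier_mat n n" "B \<in> carrier_mat n m" "D \<in> carrier_mat n d"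
    and "\<B> = stacked_response N A B"
    and "\<D> = stacked_response N A D"
    and "\<And>k. k < N \<Longrightarrow> Q k \<in> carrier_mat n n \<and> pos_semidef (Q k)"
    and "\<And>k. k < N \<Longrightarrow> R k \<in> carrier_mat m m \<and> pos_def (R k)"
    and "\<Q> = diag_block_mat (map Q [0..<N] @ [0\<^sub>m n n])"
    and "\<R> = diag_block_mat (map R [0..<N])"
    and "causal_gain N n m K"
    and "L = K * mat_inv (1\<^sub>m ((N + 1) * n) - \<B> * K)"
    and "\<Sigma>\<^sub>w \<in> carrier_mat (N * d) (N * d)" "pos_def \<Sigma>\<^sub>w"
    and "0 < \<epsilon>"
  shows "dual_value \<epsilon> \<Sigma>\<^sub>w (Xi \<B> \<D> \<Q> \<R> L) = sdp_value \<epsilon> \<Sigma>\<^sub>w \<B> \<D> \<Q> \<R> L"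
proof (rule dual_value_eq_sdp_value)
  show \<B>: "\<B> \<in> carrier_mat ((N + 1) * n) (N * m)"
    unfolding assms(8) by (rule stacked_response_carrier[OF assms(6)])
  show "\<D> \<in> carrier_mat ((N + 1) * n) (N * d)"
    unfolding assms(9) by (rule stacked_response_carrier[OF assms(7)])
  show "\<Q> \<in> carrier_mat ((N + 1) * n) ((N + 1) * n)"
  proof -
    have "diag_block_mat (map Q [0..<N] @ [0\<^sub>m n n])
        \<in> carrier_mat (length (map Q [0..<N] @ [0\<^sub>m n n]) * n) (length (map Q [0..<N] @ [0\<^sub>m n n]) * n)"
      by (rule diag_block_mat_carrier) (use assms(10) in auto)
    then show ?thesis unfolding assms(12) by simp
  qed
  show "pos_semidef \<Q>"
    unfolding assms(12) using assms(10) by (intro pos_semidef_diag_block_mat) (auto simp: pos_semidef_zero)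
  show "\<R> \<in> carrier_mat (N * m) (N * m)"
  proof -
    have "diag_block_mat (map R [0..<N])
        \<in> carrier_mat (length (map R [0..<N]) * m) (length (map R [0..<N]) * m)"
      by (rule diag_block_mat_carrier) (use assms(11) in auto)
    then show ?thesis unfolding assms(13) by simp
  qed
  show "pos_def \<R>"
    unfolding assms(13) using assms(11) by (intro pos_def_diag_block_mat) auto
  have K: "K \<in> carrier_mat (N * m) ((N + 1) * n)" using assms(14) by (simp add: causal_gain_def)
  have "mat_inv (1\<^sub>m ((N + 1) * n) - \<B> * K) \<in> carrier_mat ((N + 1) * n) ((N + 1) * n)"
  proof (rule mat_inv_if_det_nonzero(1))
    show "1\<^sub>m ((N + 1) * n) - \<B> * K \<in> carrier_mat ((N + 1) * n) ((N + 1) * n)"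
      using \<B> K by (intro minus_carrier_mat) auto
    show "det (1\<^sub>m ((N + 1) * n) - \<B> * K) \<noteq> 0"
      unfolding assms(8) det_one_minus_response_gain[OF assms(6,14)] by simp
  qed
  then show "L \<in> carrier_mat (N * m) ((N + 1) * n)" unfolding assms(15) using K by simp
  show "0 < N * d" using assms(1,4) by simp
  show "\<epsilon> \<noteq> 0" using assms(18) by simp
qed (rule assms(16,17))+

end
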